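(* Let $0<p<\infty$. Let $B=\gamma\prod_{i\in\mathbb{N}}(\alpha_iB_{a_i})^{m_i}$ be a Blaschke product with distinct zeros $a_i$ of multiplicities $m_i$, and let $\phi$ be a holomorphic self map of the open unit disk $\mathbb{D}$ with $\phi(\{a_i\}_{i\in\mathbb{N}})\subseteq\{a_i\}_{i\in\mathbb{N}}$. Then $C_\phi(BH^p)\subseteq BH^p$ if and only if, for every $i$ with $\mathrm{mult}_B(a_i)>\mathrm{mult}_B(\phi(a_i))$, one has $\phi^{(l)}(a_i)=0$ for all $1\le l\le\left\lceil\frac{\mathrm{mult}_B(a_i)}{\mathrm{mult}_B(\phi(a_i))}\right\rceil-1$.
   Context: For $a\in\mathbb{D}$, $B_a(z)=\frac{a-z}{1-\overline{a}z}$. In $B=\gamma\prod_{i\in\mathbb{N}}(\alpha_iB_{a_i})^{m_i}$ the index set may be finite, the $a_i\in\mathbb{D}$ are the distinct zeros of $B$ with multiplicities $m_i\ge1$ satisfying $\sum_i m_i(1-|a_i|)<\infty$, $\gamma$ is a unimodular constant, and $\alpha_i=|a_i|/a_i$ if $a_i\ne0$, $\alpha_i=-1$ if $a_i=0$. $\mathrm{mult}_f(w)$ is the multiplicity of the zero $w$ of $f$; $\phi^{(l)}$ is the $l$-th derivative; $\lceil x\rceil$ is the least integer $\ge x$. $H^p$ is the Hardy space on $\mathbb{D}$, $BH^p=\{Bf:f\in H^p\}$, and $C_\phi(f)=f\circ\phi$. *)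

theory Defs
  imports "HOL-Complex_Analysis.Complex_Analysis"
begin

abbreviation unit_disk :: "complex set" ("\<bbbD>")
  where "\<bbbD> \<equiv> ball 0 1"

definition blaschke_factor :: "complex \<Rightarrow> complex \<Rightarrow> complex"
  where "blaschke_factor a z = (a - z) / (1 - cnj a * z)"

definition blaschke_normalizer :: "complex \<Rightarrow> complex"
  where "blaschke_normalizer a = (if a = 0 then -1 else complex_of_real (cmod a) / a)"

(* The index set I may be any set of naturals, finite or infinite; indices outside I
   contribute the factor 1. The library's infinite product prodinf stays correct when z is a
   zero: finitely many vanishing factors are allowed and make the value 0. *)
definition blaschke_product ::
    "complex \<Rightarrow> nat set \<Rightarrow> (nat \<Rightarrow> complex) \<Rightarrow> (nat \<Rightarrow> nat) \<Rightarrow> complex \<Rightarrow> complex"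
  where "blaschke_product \<gamma> I a m z =
    \<gamma> * (\<Prod>i. if i \<in> I
                then (blaschke_normalizer (a i) * blaschke_factor (a i) z) ^ m i else 1)"

(* Members of hardy_space are total functions, whose values outside the disk are arbitrary. *)
definition hardy_space :: "real \<Rightarrow> (complex \<Rightarrow> complex) set"
  where "hardy_space p = {f. f holomorphic_on \<bbbD> \<and>
    bdd_above ((\<lambda>r. 1 / (2 * pi) *
        integral {0..2 * pi} (\<lambda>t. cmod (f (complex_of_real r * cis t)) powr p)) ` {0<..<1})}"

(* The set of all products B f with f in H^p. The product is compared on the disk only, since
   these are functions on the disk and their values elsewhere carry no meaning. *)
definition mult_hardy_space :: "(complex \<Rightarrow> complex) \<Rightarrow> real \<Rightarrow> (complex \<Rightarrow> complex) set"
  where "mult_hardy_space B p = {g. \<exists>f\<in>hardy_space p. \<forall>z\<in>\<bbbD>. g z = B z * f z}"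

definition composition_op ::
    "(complex \<Rightarrow> complex) \<Rightarrow> (complex \<Rightarrow> complex) \<Rightarrow> complex \<Rightarrow> complex"
  where "composition_op \<phi> f = f \<circ> \<phi>"

end

theory Submission
  imports Defs
begin

text \<open>Composing $Bf$ with $\<phi>$ gives $(B \<circ> \<phi>)(f \<circ> \<phi>)$, so the question is whether this function is again $B$ times a
member of $H^p$. Three facts reduce it to counting zeros.

\<^item> Littlewood subordination (\<open>littlewood_subordination\<close>, \<open>hardy_space_compose\<close>): $f \<circ> \<phi>$ is in $H^p$
  when $f$ is.
\<^item> F. Riesz division (\<open>hardy_space_divide\<close>): if $g = Bh$ with $g$ in $H^p$ and $h$ merely holomorphic,
  then $h$ is in $H^p$.
\<^item> $B$ divides a holomorphic function as soon as it does so locally at each $a_i$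
  (\<open>blaschke_product_divides\<close>).

Hence $C_\<phi>$ preserves $BH^p$ iff $B \<circ> \<phi>$ vanishes at each $a_i$ to order at least $m_i$; necessity is seen on
$B = B \<cdot> 1$. If $\<phi>(a_i) = a_j$ and $\<phi> - a_j$ vanishes at $a_i$ to order exactly $n$, then $B \<circ> \<phi>$ vanishes
there to order $n m_j$, and $n m_j \<ge> m_i$ says that $n \<ge> \<lceil>m_i / m_j\<rceil>$, which is the derivative condition. A
constant $\<phi>$ makes both sides true.

The first two facts rest on one inequality, the Poisson majorization of $|f|^p$
(\<open>norm_powr_le_poisson\<close>), which holds for all $p > 0$: a zero-free $f$ has a holomorphic $p$-th power, and each
zero can be replaced by a reflected factor that leaves $|f|$ unchanged on the circle and enlarges it
inside. It is proved for circles without zeros of $f$; their radii come arbitrarily close to 1, and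
that is enough to bound all means.\<close>

section \<open>The Poisson integral\<close>

definition poisson_kernel :: "real \<Rightarrow> real \<Rightarrow> complex \<Rightarrow> real"
  where "poisson_kernel R t z = (R\<^sup>2 - (cmod z)\<^sup>2) / (cmod (complex_of_real R * cis t - z))\<^sup>2"

lemma cmod_of_real_mult_cis [simp]: "cmod (complex_of_real r * cis t) = \<bar>r\<bar>"
  by (simp add: norm_mult)

text \<open>Cauchy's formula for $F(w) (R^2 - |z|^2) / (R^2 - \<open>cnj z\<close> \<cdot> w)$, a function that takes the value $F(z)$ at $w = z$.
On the circle $|w| = R$ the quotient $w / ((R^2 - \<open>cnj z\<close> \<cdot> w)(w - z))$ is $1 / |w - z|^2$, so the Cauchy kernel
turns into the Poisson kernel.\<close>
lemma poisson_formula: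
  assumes cont: "continuous_on (cball 0 R) F" and hol: "F holomorphic_on ball 0 R"
    and z: "cmod z < R"
  shows "((\<lambda>t. of_real (poisson_kernel R t z) * F (complex_of_real R * cis t))
           has_integral (of_real (2 * pi) * F z)) {0..2 * pi}"
proof -
  have R: "R > 0" using z by (meson norm_ge_zero le_less_trans)
  have nz: "complex_of_real (R\<^sup>2) - cnj z * w \<noteq> 0" if "cmod w \<le> R" for w
  proof
    assume "complex_of_real (R\<^sup>2) - cnj z * w = 0"
    hence "complex_of_real (R\<^sup>2) = cnj z * w" by simp
    hence "cmod (complex_of_real (R\<^sup>2)) = cmod z * cmod w" by (simp add: norm_mult)
    hence "R\<^sup>2 = cmod z * cmod w" by (simp only: norm_of_real) simp
    moreover have "cmod z * cmod w \<le> cmod z * R"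
      using that by (simp add: mult_left_mono)
    moreover have "cmod z * R < R * R" using z R by simp
    ultimately show False by (simp add: power2_eq_square)
  qed
  define G where "G = (\<lambda>w. F w * of_real (R\<^sup>2 - (cmod z)\<^sup>2) / (of_real (R\<^sup>2) - cnj z * w))"
  have "continuous_on (cball 0 R) G" unfolding G_def
    by (intro continuous_intros cont) (use nz in auto)
  moreover have "G holomorphic_on ball 0 R" unfolding G_def
    by (intro holomorphic_intros hol) (use nz in auto)
  ultimately have "((\<lambda>u. G u / (u - z)) has_contour_integral (2 * of_real pi * \<i> * G z))
                     (circlepath 0 R)"
    by (rule Cauchy_integral_circlepath) (use z in simp)
  hence "((\<lambda>t. G (R * cis t) / (R * cis t - z) * R * \<i> * cis t)
           has_integral (2 * of_real pi * \<i> * G z)) {0..2 * pi}"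
    unfolding circlepath_def by (subst (asm) has_contour_integral_part_circlepath_iff) auto
  hence *: "((\<lambda>t. (- \<i>) * (G (R * cis t) / (R * cis t - z) * R * \<i> * cis t))
           has_integral ((- \<i>) * (2 * of_real pi * \<i> * G z))) {0..2 * pi}"
    by (rule has_integral_mult_right)
  have Gz: "G z = F z"
  proof -
    have "complex_of_real (R\<^sup>2 - (cmod z)\<^sup>2) = of_real (R\<^sup>2) - cnj z * z"
      unfolding of_real_diff complex_norm_square by (simp add: mult.commute)
    thus ?thesis using nz[of z] z by (simp add: G_def)
  qed
  have eq: "(- \<i>) * (G (R * cis t) / (R * cis t - z) * R * \<i> * cis t)
      = of_real (poisson_kernel R t z) * F (complex_of_real R * cis t)" for t
  proof -
    define w where "w = complex_of_real R * cis t"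
    have cw: "cmod w = R" using R by (simp add: w_def)
    have w0: "w \<noteq> 0" using cw R by auto
    have wz: "w - z \<noteq> 0" using cw z by auto
    have wwc: "complex_of_real (R\<^sup>2) = w * cnj w" using complex_norm_square[of w] by (simp only: cw)
    have den: "complex_of_real (R\<^sup>2) - cnj z * w = w * cnj (w - z)"
      unfolding wwc by (simp add: algebra_simps)
    have sq: "complex_of_real ((cmod (w - z))\<^sup>2) = (w - z) * cnj (w - z)"
      by (rule complex_norm_square)
    have "(- \<i>) * (G w / (w - z) * R * \<i> * cis t) = G w * w / (w - z)"
      by (simp add: w_def field_simps)
    also have "\<dots> = F w * of_real (R\<^sup>2 - (cmod z)\<^sup>2) / (w * cnj (w - z)) * w / (w - z)"
      by (simp only: G_def den)
    also have "\<dots> = F w * of_real (R\<^sup>2 - (cmod z)\<^sup>2) / ((w - z) * cnj (w - z))"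
      using w0 wz by (simp add: field_simps del: complex_cnj_diff)
    also have "\<dots> = of_real (poisson_kernel R t z) * F w"
      unfolding sq[symmetric] poisson_kernel_def w_def[symmetric] of_real_divide by simp
    finally show ?thesis by (simp add: w_def)
  qed
  have "(- \<i>) * (2 * of_real pi * \<i> * G z) = of_real (2 * pi) * F z"
    by (simp add: Gz field_simps)
  with * show ?thesis by (simp only: eq)
qed

lemma circle_point_ne:
  assumes "cmod z < R"
  shows "complex_of_real R * cis t - z \<noteq> 0"
  using assms by (metis abs_of_pos cmod_of_real_mult_cis eq_iff_diff_eq_0 less_irrefl
      norm_ge_zero order_le_less_trans)

lemma poisson_kernel_nonneg:
  assumes "cmod z < R" shows "poisson_kernel R t z \<ge> 0"
proof -
  have "(cmod z)\<^sup>2 \<le> R\<^sup>2" using assms by (intro power_mono) auto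
  thus ?thesis by (simp add: poisson_kernel_def)
qed

lemma poisson_kernel_le:
  assumes "cmod z < R" shows "poisson_kernel R t z \<le> (R + cmod z) / (R - cmod z)"
proof -
  have R: "R > 0" using assms by (meson norm_ge_zero le_less_trans)
  have "R - cmod z \<le> cmod (complex_of_real R * cis t - z)"
    using norm_triangle_ineq2[of "complex_of_real R * cis t" z] R by simp
  hence "(R - cmod z)\<^sup>2 \<le> (cmod (complex_of_real R * cis t - z))\<^sup>2"
    using assms by (intro power_mono) auto
  moreover have "0 \<le> R\<^sup>2 - (cmod z)\<^sup>2" using power_mono[of "cmod z" R 2] assms by simp
  ultimately have "poisson_kernel R t z \<le> (R\<^sup>2 - (cmod z)\<^sup>2) / (R - cmod z)\<^sup>2"
    unfolding poisson_kernel_def using assms by (intro divide_left_mono mult_pos_pos)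
      (auto simp: circle_point_ne intro!: zero_less_power)
  also have "\<dots> = (R + cmod z) / (R - cmod z)"
  proof -
    have "R\<^sup>2 - (cmod z)\<^sup>2 = (R + cmod z) * (R - cmod z)"
      by (simp add: power2_eq_square algebra_simps)
    thus ?thesis using assms by (simp add: power2_eq_square)
  qed
  finally show ?thesis .
qed

lemma poisson_kernel_zero [simp]: "R \<noteq> 0 \<Longrightarrow> poisson_kernel R t 0 = 1"
  by (simp add: poisson_kernel_def norm_mult)

lemma poisson_kernel_eq_Re:
  assumes "cmod z < R"
  shows "poisson_kernel R t z
           = Re ((complex_of_real R * cis t + z) / (complex_of_real R * cis t - z))"
proof -
  define w where "w = complex_of_real R * cis t"
  have R: "R > 0" using assms by (meson norm_ge_zero le_less_trans)
  have "Re ((w + z) / (w - z)) = Re ((w + z) * cnj (w - z)) / (cmod (w - z))\<^sup>2"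
    by (metis Re_divide_of_real complex_div_cnj of_real_power)
  also have "Re ((w + z) * cnj (w - z)) = (cmod w)\<^sup>2 - (cmod z)\<^sup>2"
    unfolding cmod_power2 by (simp add: power2_eq_square algebra_simps)
  also have "cmod w = R" using R by (simp add: w_def)
  finally show ?thesis by (simp add: poisson_kernel_def w_def)
qed

lemma continuous_on_poisson_kernel:
  assumes "continuous_on A T" "continuous_on A Z" "\<And>x. x \<in> A \<Longrightarrow> cmod (Z x) < R"
  shows "continuous_on A (\<lambda>x. poisson_kernel R (T x) (Z x))"
  unfolding poisson_kernel_def
  by (intro continuous_intros assms) (use circle_point_ne assms(3) in auto)

text \<open>For a fixed point of the outer circle the kernel is the real part of a holomorphic function of $z$
(\<open>poisson_kernel_eq_Re\<close>). After composition with $\<phi>$ it is still one, hence has the mean value property.\<close>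
lemma poisson_kernel_mean:
  assumes cont: "continuous_on (cball 0 r) \<phi>" and hol: "\<phi> holomorphic_on ball 0 r"
    and r: "r > 0" and bd: "\<And>z. z \<in> cball 0 r \<Longrightarrow> cmod (\<phi> z) < R"
  shows "((\<lambda>s. poisson_kernel R t (\<phi> (complex_of_real r * cis s)))
           has_integral (2 * pi * poisson_kernel R t (\<phi> 0))) {0..2 * pi}"
proof -
  define H where
    "H = (\<lambda>z. (complex_of_real R * cis t + \<phi> z) / (complex_of_real R * cis t - \<phi> z))"
  have nz: "complex_of_real R * cis t - \<phi> z \<noteq> 0" if "cmod z \<le> r" for z
    using circle_point_ne[OF bd, of z] that by simp
  have "continuous_on (cball 0 r) H" "H holomorphic_on ball 0 r"
    unfolding H_def using nz by (intro continuous_intros holomorphic_intros cont hol; force)+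
  from poisson_formula[OF this, of 0] r
  have "((\<lambda>s. H (complex_of_real r * cis s)) has_integral (of_real (2 * pi) * H 0)) {0..2 * pi}"
    by simp
  hence "((\<lambda>s. Re (H (complex_of_real r * cis s))) has_integral (Re (of_real (2 * pi) * H 0))) {0..2 * pi}"
    by (rule has_integral_linear[OF _ bounded_linear_Re, unfolded o_def])
  moreover have "Re (H z) = poisson_kernel R t (\<phi> z)" if "cmod z \<le> r" for z
    using poisson_kernel_eq_Re[OF bd, of z t] that by (simp add: H_def)
  ultimately show ?thesis using r by (simp del: of_real_mult)
qed

lemma continuous_on_norm_powr_circle:
  fixes f :: "complex \<Rightarrow> complex" and p R :: real
  assumes "continuous_on (sphere 0 \<bar>R\<bar>) f" "p > 0"
  shows "continuous_on A (\<lambda>t. cmod (f (complex_of_real R * cis t)) powr p)"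
proof -
  have "continuous_on A (f \<circ> (\<lambda>t. complex_of_real R * cis t))"
    by (rule continuous_on_compose) (auto intro!: continuous_intros continuous_on_subset[OF assms(1)])
  hence "continuous_on A (\<lambda>t. f (complex_of_real R * cis t))" by (simp add: o_def)
  thus ?thesis using assms(2) by (intro continuous_on_powr' continuous_intros) auto
qed

text \<open>With $f = \<open>exp g\<close>$ near the closed disk, $\<open>exp (p g)\<close>$ is a holomorphic function of modulus $|f|^p$, and
the Poisson formula represents it with a positive kernel.\<close>
lemma norm_powr_le_poisson_zero_free:
  fixes f :: "complex \<Rightarrow> complex" and p :: real
  assumes hol: "f holomorphic_on ball 0 S" and RS: "R < S" and p: "p > 0"
    and nz: "\<And>z. z \<in> cball 0 R \<Longrightarrow> f z \<noteq> 0" and z: "cmod z < R"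
  shows "2 * pi * cmod (f z) powr p \<le> integral {0..2 * pi}
           (\<lambda>t. poisson_kernel R t z * cmod (f (complex_of_real R * cis t)) powr p)"
proof -
  have R: "R > 0" using z by (meson norm_ge_zero le_less_trans)
  have contf: "continuous_on (ball 0 S) f" using hol by (rule holomorphic_on_imp_continuous_on)
  have "open (ball 0 S \<inter> f -` (- {0}))"
    by (rule continuous_open_preimage[OF contf]) auto
  moreover have "cball 0 R \<subseteq> ball 0 S \<inter> f -` (- {0})" using nz RS by auto
  ultimately obtain e where e: "e > 0" "(\<Union>x\<in>cball 0 R. cball x e) \<subseteq> ball 0 S \<inter> f -` (- {0})"
    using compact_subset_open_imp_cball_epsilon_subset[OF compact_cball] by metis
  \<comment> \<open>Each point outside the closed disk is compared with its radial projection to the circle.\<close>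
  have sub: "ball 0 (R + e) \<subseteq> ball 0 S \<inter> f -` (- {0})"
  proof -
    have "\<exists>x\<in>cball 0 R. y \<in> cball x e" if "y \<in> ball 0 (R + e)" for y :: complex
    proof (cases "cmod y \<le> R")
      case True thus ?thesis using e(1) by (intro bexI[of _ y]) auto
    next
      case False
      hence y0: "cmod y > 0" using R by linarith
      define x where "x = (R / cmod y) *\<^sub>R y"
      have "x - y = (R / cmod y - 1) *\<^sub>R y" by (simp add: x_def scaleR_diff_left)
      hence "cmod (x - y) = \<bar>R / cmod y - 1\<bar> * cmod y" by simp
      also have "\<dots> = cmod y - R" using False y0 R by (simp add: abs_if field_simps)
      finally have "dist x y \<le> e" using that by (simp add: dist_norm)
      moreover have "cmod x = R" using y0 R by (simp add: x_def)
      ultimately show ?thesis by (intro bexI[of _ x]) auto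
    qed
    thus ?thesis using e(2) by blast
  qed
  have "f holomorphic_on ball 0 (R + e)" using hol sub by (meson holomorphic_on_subset le_inf_iff)
  then obtain g where g: "g holomorphic_on ball 0 (R + e)"
      "\<And>z. z \<in> ball 0 (R + e) \<Longrightarrow> f z = exp (g z)"
    by (rule contractible_imp_holomorphic_log) (use sub in \<open>auto intro: convex_imp_contractible\<close>)
  define F where "F = (\<lambda>z. exp (of_real p * g z))"
  have normF: "cmod (F z) = cmod (f z) powr p" if "z \<in> ball 0 (R + e)" for z
    using g(2)[OF that] by (simp add: F_def exp_powr_real mult.commute)
  have holF: "F holomorphic_on ball 0 (R + e)"
    unfolding F_def by (intro holomorphic_intros g)
  have contF: "continuous_on (cball 0 R) F"
    using holF e(1) by (auto intro!: holomorphic_on_imp_continuous_on elim!: holomorphic_on_subset)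
  have int: "((\<lambda>t. of_real (poisson_kernel R t z) * F (complex_of_real R * cis t))
      has_integral (of_real (2 * pi) * F z)) {0..2 * pi}"
    using e(1) by (intro poisson_formula contF z holomorphic_on_subset[OF holF]) auto
  have "cmod (of_real (2 * pi) * F z) \<le> integral {0..2 * pi}
           (\<lambda>t. poisson_kernel R t z * cmod (f (complex_of_real R * cis t)) powr p)"
    unfolding integral_unique[OF int, symmetric]
  proof (rule integral_norm_bound_integral)
    show "(\<lambda>t. of_real (poisson_kernel R t z) * F (complex_of_real R * cis t))
            integrable_on {0..2 * pi}" using int by blast
    have "continuous_on {0..2 * pi} (\<lambda>t. poisson_kernel R t z * cmod (f (complex_of_real R * cis t)) powr p)"
      using z R RS p by (intro continuous_intros continuous_on_poisson_kernel
          continuous_on_norm_powr_circle continuous_on_subset[OF contf]) auto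
    thus "(\<lambda>t. poisson_kernel R t z * cmod (f (complex_of_real R * cis t)) powr p)
            integrable_on {0..2 * pi}" by (rule integrable_continuous_real)
  next
    fix t assume "t \<in> {0..2 * pi}"
    show "cmod (of_real (poisson_kernel R t z) * F (complex_of_real R * cis t))
        \<le> poisson_kernel R t z * cmod (f (complex_of_real R * cis t)) powr p"
      using normF[of "complex_of_real R * cis t"] e(1) R poisson_kernel_nonneg[OF z, of t]
      by (simp add: norm_mult)
  qed
  moreover have "cmod (of_real (2 * pi) * F z) = 2 * pi * cmod (f z) powr p"
    using normF[of z] z e(1) by (simp add: norm_mult)
  ultimately show ?thesis by simp
qed

lemma holomorphic_factor_zero_global:
  assumes hol: "f holomorphic_on S" and S: "open S" "connected S" and w: "w \<in> S" "f w = 0"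
    and nz: "v \<in> S" "f v \<noteq> 0"
  obtains g n where "g holomorphic_on S" "g w \<noteq> 0" "\<And>z. z \<in> S \<Longrightarrow> f z = (z - w) ^ n * g z"
proof -
  have "\<not> f constant_on S" using w nz unfolding constant_on_def by metis
  then obtain g r n where g: "0 < n" "0 < r" "ball w r \<subseteq> S" "g holomorphic_on ball w r"
      "\<And>z. z \<in> ball w r \<Longrightarrow> f z = (z - w) ^ n * g z" "\<And>z. z \<in> ball w r \<Longrightarrow> g z \<noteq> 0"
    using holomorphic_factor_zero_nonconstant[OF hol S w] by metis
  define G where "G = (\<lambda>z. if z = w then g w else f z / (z - w) ^ n)"
  have "G holomorphic_on (S - {w})"
  proof (rule holomorphic_transform)
    show "(\<lambda>z. f z / (z - w) ^ n) holomorphic_on (S - {w})"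
      by (intro holomorphic_intros holomorphic_on_subset[OF hol]) auto
  qed (auto simp: G_def)
  moreover have "G holomorphic_on (ball w r)"
    by (rule holomorphic_transform[OF g(4)]) (use g in \<open>auto simp: G_def\<close>)
  moreover have "S = (S - {w}) \<union> ball w r" using g w by auto
  ultimately have "G holomorphic_on S"
    using holomorphic_on_Un[of G "S - {w}" "ball w r"] S by (auto simp: open_delete)
  moreover have "G w \<noteq> 0" using g by (simp add: G_def)
  moreover have "f z = (z - w) ^ n * G z" if "z \<in> S" for z
    using w g(1) by (auto simp: G_def)
  ultimately show ?thesis using that by blast
qed

text \<open>The factor $(R^2 - \<open>cnj w\<close> \<cdot> z) / R$ is $z - w$ divided by the Blaschke factor of $w$ for the disk of radius $R$.
The lemma rests on the identity
$|R^2 - \<open>cnj w\<close> \<cdot> z|^2 - R^2 |z - w|^2 = (R^2 - |w|^2)(R^2 - |z|^2)$.\<close>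
lemma reflected_factor:
  assumes "R > 0" "cmod w < R"
  shows "cmod z \<le> R \<Longrightarrow> of_real (R\<^sup>2) - cnj w * z \<noteq> 0"
    and "cmod z \<le> R \<Longrightarrow> cmod (z - w) \<le> cmod ((of_real (R\<^sup>2) - cnj w * z) / of_real R)"
    and "cmod z = R \<Longrightarrow> cmod ((of_real (R\<^sup>2) - cnj w * z) / of_real R) = cmod (z - w)"
proof -
  have id: "(cmod (of_real (R\<^sup>2) - cnj w * z))\<^sup>2 - R\<^sup>2 * (cmod (z - w))\<^sup>2
              = (R\<^sup>2 - (cmod w)\<^sup>2) * (R\<^sup>2 - (cmod z)\<^sup>2)"
    unfolding cmod_power2 by (simp add: power2_eq_square algebra_simps)
  have w2: "R\<^sup>2 - (cmod w)\<^sup>2 > 0" using power_strict_mono[of "cmod w" R 2] assms by simp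
  have n: "cmod ((of_real (R\<^sup>2) - cnj w * z) / of_real R) = cmod (of_real (R\<^sup>2) - cnj w * z) / R"
    using assms by (simp add: norm_divide)
  {
    assume "cmod z \<le> R"
    hence "(cmod z)\<^sup>2 \<le> R\<^sup>2" by (intro power_mono) auto
    hence "(R * cmod (z - w))\<^sup>2 \<le> (cmod (of_real (R\<^sup>2) - cnj w * z))\<^sup>2"
      using id w2 by (simp add: power_mult_distrib)
       (metis diff_ge_0_iff_ge less_eq_real_def mult_nonneg_nonneg)
    hence "R * cmod (z - w) \<le> cmod (of_real (R\<^sup>2) - cnj w * z)"
      by (rule power2_le_imp_le) simp
    thus "cmod (z - w) \<le> cmod ((of_real (R\<^sup>2) - cnj w * z) / of_real R)"
      unfolding n using assms by (simp add: pos_le_divide_eq mult.commute)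
  }
  {
    assume "cmod z = R"
    hence "(R * cmod (z - w))\<^sup>2 = (cmod (of_real (R\<^sup>2) - cnj w * z))\<^sup>2"
      using id by (simp add: power_mult_distrib)
    hence "R * cmod (z - w) = cmod (of_real (R\<^sup>2) - cnj w * z)"
      using assms by (subst (asm) power2_eq_iff_nonneg) auto
    thus "cmod ((of_real (R\<^sup>2) - cnj w * z) / of_real R) = cmod (z - w)"
      unfolding n using assms by (simp add: field_simps)
  }
  assume z: "cmod z \<le> R"
  show "of_real (R\<^sup>2) - cnj w * z \<noteq> 0"
  proof
    assume "of_real (R\<^sup>2) - cnj w * z = 0"
    hence "complex_of_real (R\<^sup>2) = cnj w * z" by simp
    hence "cmod (complex_of_real (R\<^sup>2)) = cmod w * cmod z" by (simp add: norm_mult)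
    hence "R\<^sup>2 = cmod w * cmod z" by (simp only: norm_of_real) simp
    moreover have "cmod w * cmod z \<le> cmod w * R" using z by (simp add: mult_left_mono)
    moreover have "cmod w * R < R * R" using assms by simp
    ultimately show False by (simp add: power2_eq_square)
  qed
qed

text \<open>Induction on the number of zeros in the disk. Replacing the factor $(z - w)^k$ of a zero $w$ by its reflected
factor removes that zero, keeps $|f|$ on the circle and does not decrease it inside, so the inequality
for the new function implies the one for $f$.\<close>
lemma norm_powr_le_poisson:
  fixes f :: "complex \<Rightarrow> complex" and p :: real
  assumes "f holomorphic_on ball 0 S" and RS: "R < S" and p: "p > 0"
    and "\<And>z. z \<in> sphere 0 R \<Longrightarrow> f z \<noteq> 0" and z: "cmod z < R"
  shows "2 * pi * cmod (f z) powr p \<le> integral {0..2 * pi}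
           (\<lambda>t. poisson_kernel R t z * cmod (f (complex_of_real R * cis t)) powr p)"
proof -
  have R: "R > 0" using z by (meson norm_ge_zero le_less_trans)
  have fin: "finite {w \<in> cball 0 R. h w = 0}"
    if "h holomorphic_on ball 0 S" and "\<And>z. z \<in> sphere 0 R \<Longrightarrow> h z \<noteq> 0" for h
  proof (cases "h constant_on ball 0 S")
    case True
    have "h (of_real R) \<noteq> 0" using that(2) R by simp
    hence "{w \<in> cball 0 R. h w = 0} = {}"
      using True R RS unfolding constant_on_def by force
    thus ?thesis by (simp only: finite.emptyI)
  next
    case False
    moreover have "cball 0 R \<subseteq> ball (0::complex) S" using RS by (intro subsetI) auto
    ultimately show ?thesis
      using holomorphic_compact_finite_zeros[of h "ball 0 S" "cball 0 R"] that(1)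
      by (auto simp del: mem_cball_0)
  qed
  show ?thesis
    using assms(1,4)
  proof (induction "card {w \<in> cball 0 R. f w = 0}" arbitrary: f)
    case 0
    have "finite {w \<in> cball 0 R. f w = 0}" by (rule fin) fact+
    hence "\<And>w. w \<in> cball 0 R \<Longrightarrow> f w \<noteq> 0" using "0.hyps" by auto
    thus ?case by (intro norm_powr_le_poisson_zero_free[OF "0.prems"(1) RS p _ z])
  next
    case (Suc n)
    have "finite {w \<in> cball 0 R. f w = 0}" by (rule fin) fact+
    have "{w \<in> cball 0 R. f w = 0} \<noteq> {}" using Suc.hyps(2) by (metis card.empty nat.distinct(1))
    then obtain w where w: "cmod w \<le> R" "f w = 0" by auto
    have wR: "cmod w < R" using w Suc.prems(2)[of w] by fastforce
    obtain g k where g: "g holomorphic_on ball 0 S" "g w \<noteq> 0"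
        "\<And>z. z \<in> ball 0 S \<Longrightarrow> f z = (z - w) ^ k * g z"
      by (rule holomorphic_factor_zero_global[of f "ball 0 S" w "of_real R"])
         (use Suc.prems R RS wR w in auto)
    define q where "q = (\<lambda>z. (of_real (R\<^sup>2) - cnj w * z) / of_real R)"
    define f' where "f' = (\<lambda>z. q z ^ k * g z)"
    note q = reflected_factor[OF R wR, folded q_def]
    have qz: "q z \<noteq> 0" if "cmod z \<le> R" for z
      using reflected_factor(1)[OF R wR that] R by (simp add: q_def)
    have eq: "cmod (f' z) = cmod (f z)" if "cmod z = R" for z
      using g(3)[of z] q(3)[OF that] that RS by (simp add: f'_def norm_mult norm_power q_def)
    have le: "cmod (f z) \<le> cmod (f' z)"
      using g(3)[of z] q(2)[of z] z RS
      by (auto simp: f'_def norm_mult norm_power q_def intro!: mult_right_mono power_mono)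
    have "{z \<in> cball 0 R. f' z = 0} = {z \<in> cball 0 R. f z = 0} - {w}"
    proof (intro set_eqI iffI)
      fix z assume "z \<in> {z \<in> cball 0 R. f' z = 0}"
      thus "z \<in> {z \<in> cball 0 R. f z = 0} - {w}" using g(2) g(3)[of z] qz[of z] RS by (auto simp: f'_def)
    next
      fix z assume "z \<in> {z \<in> cball 0 R. f z = 0} - {w}"
      thus "z \<in> {z \<in> cball 0 R. f' z = 0}" using g(3)[of z] RS by (auto simp: f'_def)
    qed
    hence "n = card {z \<in> cball 0 R. f' z = 0}" using Suc.hyps(2) w by simp
    moreover have "f' holomorphic_on ball 0 S" unfolding f'_def q_def
      using R by (intro holomorphic_intros g) auto
    moreover have "f' z \<noteq> 0" if "z \<in> sphere 0 R" for z
      using eq[of z] Suc.prems(2)[OF that] that by auto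
    ultimately have "2 * pi * cmod (f' z) powr p \<le> integral {0..2 * pi}
             (\<lambda>t. poisson_kernel R t z * cmod (f' (complex_of_real R * cis t)) powr p)"
      by (rule Suc.hyps(1))
    also have "\<dots> = integral {0..2 * pi}
             (\<lambda>t. poisson_kernel R t z * cmod (f (complex_of_real R * cis t)) powr p)"
      using R by (simp add: eq)
    finally have "2 * pi * cmod (f' z) powr p \<le> \<dots>" .
    moreover have "2 * pi * cmod (f z) powr p \<le> 2 * pi * cmod (f' z) powr p"
      using le p by (intro mult_left_mono powr_mono2) auto
    ultimately show ?case by linarith
  qed
qed

section \<open>Integral means and Littlewood subordination\<close>

definition circle_mean :: "(complex \<Rightarrow> real) \<Rightarrow> real \<Rightarrow> real"
  where "circle_mean u r = 1 / (2 * pi) * integral {0..2 * pi} (\<lambda>t. u (complex_of_real r * cis t))"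

lemma ex_zero_free_circle:
  assumes hol: "f holomorphic_on \<bbbD>" and v: "v \<in> \<bbbD>" "f v \<noteq> 0" and \<rho>: "\<rho> < 1"
  obtains R where "\<rho> < R" "0 < R" "R < 1" "\<And>z. z \<in> sphere 0 R \<Longrightarrow> f z \<noteq> 0"
proof -
  define a b where "a = max \<rho> 0" and "b = (max \<rho> 0 + 1) / 2"
  have ab: "0 \<le> a" "\<rho> \<le> a" "a < b" "b < 1" using \<rho> by (auto simp: a_def b_def)
  have sub: "cball 0 b \<subseteq> \<bbbD>" using ab by (intro subsetI) auto
  have "finite {z \<in> cball 0 b. f z = 0}"
  proof (cases "f constant_on \<bbbD>")
    case True
    then obtain c where c: "\<And>x. x \<in> \<bbbD> \<Longrightarrow> f x = c" unfolding constant_on_def by blast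
    have "c \<noteq> 0" using c[OF v(1)] v(2) by simp
    hence "{z \<in> cball 0 b. f z = 0} = {}" using c sub by blast
    thus ?thesis by (simp only: finite.emptyI)
  next
    case False
    thus ?thesis using holomorphic_compact_finite_zeros[OF hol _ _ _ sub False] by simp
  qed
  hence "finite (cmod ` {z \<in> cball 0 b. f z = 0})" by simp
  moreover have "infinite {a<..<b}" using ab by simp
  ultimately obtain R where R: "R \<in> {a<..<b}" "R \<notin> cmod ` {z \<in> cball 0 b. f z = 0}"
    by (meson finite_subset subsetI)
  show ?thesis
  proof (rule that[of R])
    fix z :: complex assume "z \<in> sphere 0 R"
    thus "f z \<noteq> 0" using R by force
  qed (use R ab in auto)
qed

lemma ex_radius_le_poisson:
  fixes p :: real
  assumes hol: "f holomorphic_on \<bbbD>" and p: "p > 0" and \<rho>: "\<rho> < 1"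
  obtains R where "\<rho> < R" "0 < R" "R < 1"
    "\<And>z. cmod z < R \<Longrightarrow> 2 * pi * cmod (f z) powr p \<le> integral {0..2 * pi}
           (\<lambda>t. poisson_kernel R t z * cmod (f (complex_of_real R * cis t)) powr p)"
proof (cases "\<exists>v\<in>\<bbbD>. f v \<noteq> 0")
  case True
  then obtain v where "v \<in> \<bbbD>" "f v \<noteq> 0" by blast
  then obtain R where R: "\<rho> < R" "0 < R" "R < 1" "\<And>z. z \<in> sphere 0 R \<Longrightarrow> f z \<noteq> 0"
    using ex_zero_free_circle[OF hol _ _ \<rho>] by metis
  show ?thesis by (rule that[OF R(1-3)]) (rule norm_powr_le_poisson[OF hol R(3) p R(4)])
next
  case False
  define R where "R = (max \<rho> 0 + 1) / 2"
  have R: "\<rho> < R" "0 < R" "R < 1" using \<rho> by (auto simp: R_def)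
  show ?thesis by (rule that[OF R]) (use False p R in auto)
qed

lemma circle_mean_mono:
  assumes "continuous_on {0..2 * pi} (\<lambda>t. u (complex_of_real r * cis t))"
    and "continuous_on {0..2 * pi} (\<lambda>t. v (complex_of_real s * cis t))"
    and "\<And>t. t \<in> {0..2 * pi} \<Longrightarrow> u (complex_of_real r * cis t) \<le> c * v (complex_of_real s * cis t)"
  shows "circle_mean u r \<le> c * circle_mean v s"
proof -
  have "integral {0..2 * pi} (\<lambda>t. u (complex_of_real r * cis t))
      \<le> integral {0..2 * pi} (\<lambda>t. c * v (complex_of_real s * cis t))"
    by (intro integral_le integrable_continuous_real continuous_intros assms) auto
  also have "\<dots> = c * integral {0..2 * pi} (\<lambda>t. v (complex_of_real s * cis t))"
    by (rule integral_mult_right)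
  finally have "1 / (2 * pi) * integral {0..2 * pi} (\<lambda>t. u (complex_of_real r * cis t))
      \<le> 1 / (2 * pi) * (c * integral {0..2 * pi} (\<lambda>t. v (complex_of_real s * cis t)))"
    by (intro mult_left_mono) auto
  thus ?thesis unfolding circle_mean_def by (simp add: mult_ac)
qed

lemma norm_less_on_cball:
  fixes \<phi> :: "complex \<Rightarrow> complex"
  assumes "continuous_on (cball 0 r) \<phi>" "\<And>z. z \<in> cball 0 r \<Longrightarrow> cmod (\<phi> z) < c" "r \<ge> 0"
  obtains d where "d < c" "\<And>z. z \<in> cball 0 r \<Longrightarrow> cmod (\<phi> z) \<le> d"
proof -
  have "\<exists>x\<in>cball 0 r. \<forall>y\<in>cball 0 r. cmod (\<phi> y) \<le> cmod (\<phi> x)"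
    using assms by (intro continuous_attains_sup continuous_intros) auto
  thus ?thesis using that assms(2) by blast
qed

lemma continuous_on_norm_powr_disk:
  fixes f :: "complex \<Rightarrow> complex" and p r :: real
  assumes "f holomorphic_on \<bbbD>" "p > 0" "0 \<le> r" "r < 1"
  shows "continuous_on A (\<lambda>t. cmod (f (complex_of_real r * cis t)) powr p)"
  using assms by (intro continuous_on_norm_powr_circle holomorphic_on_imp_continuous_on)
    (auto elim: holomorphic_on_subset)

text \<open>Apply the Poisson majorization at the points $\<phi>(r e^{is})$ and average over $s$. After exchanging the
integrals, the kernel is averaged over $s$, which gives its value at $\<phi>(0)$; that value is bounded
independently of $t$. The parameter $\<rho>$ lets the outer radius be taken as close to 1 as needed.\<close>
theorem littlewood_subordination:
  fixes p :: real
  assumes f: "f holomorphic_on \<bbbD>" and \<phi>: "\<phi> holomorphic_on \<bbbD>" "\<phi> ` \<bbbD> \<subseteq> \<bbbD>"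
    and p: "p > 0" and r: "0 < r" "r < 1" and \<rho>: "\<rho> < 1"
  obtains R where "\<rho> < R" "cmod (\<phi> 0) < R" "R < 1"
    "circle_mean (\<lambda>z. cmod (f (\<phi> z)) powr p) r
       \<le> (R + cmod (\<phi> 0)) / (R - cmod (\<phi> 0)) * circle_mean (\<lambda>z. cmod (f z) powr p) R"
proof -
  have sub: "cball 0 r \<subseteq> \<bbbD>" using r by (intro subsetI) auto
  have cont\<phi>: "continuous_on (cball 0 r) \<phi>"
    using \<phi>(1) sub by (meson holomorphic_on_imp_continuous_on holomorphic_on_subset)
  have hol\<phi>: "\<phi> holomorphic_on ball 0 r"
    using \<phi>(1) sub by (meson ball_subset_cball holomorphic_on_subset subset_trans)
  have "cmod (\<phi> z) < 1" if "z \<in> cball 0 r" for z using that sub \<phi>(2) by fastforce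
  then obtain d where d: "d < 1" "\<And>z. z \<in> cball 0 r \<Longrightarrow> cmod (\<phi> z) \<le> d"
    using norm_less_on_cball[OF cont\<phi>, of 1] r by auto
  \<comment> \<open>The outer circle must enclose the image of the closed disk of radius r, which d bounds.\<close>
  obtain R where R: "max \<rho> d < R" "0 < R" "R < 1"
    "\<And>z. cmod z < R \<Longrightarrow> 2 * pi * cmod (f z) powr p \<le> integral {0..2 * pi}
           (\<lambda>t. poisson_kernel R t z * cmod (f (complex_of_real R * cis t)) powr p)"
    by (rule ex_radius_le_poisson[OF f p, of "max \<rho> d"]) (use \<rho> d in auto)
  have bd: "cmod (\<phi> z) < R" if "z \<in> cball 0 r" for z using d(2)[OF that] R(1) by simp
  have bd': "cmod (\<phi> (complex_of_real r * cis s)) < R" for s by (rule bd) (use r in simp)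
  have bd0: "cmod (\<phi> 0) < R" using r by (intro bd) auto
  define C where "C = (R + cmod (\<phi> 0)) / (R - cmod (\<phi> 0))"
  define u where "u = (\<lambda>t. cmod (f (complex_of_real R * cis t)) powr p)"
  define K where "K = (\<lambda>s t. poisson_kernel R t (\<phi> (complex_of_real r * cis s)))"
  have contu: "continuous_on A u" for A unfolding u_def
    by (rule continuous_on_norm_powr_disk) (use f p R in auto)
  have cont\<phi>': "continuous_on A (\<lambda>s. \<phi> (complex_of_real r * cis s))" for A
    by (rule continuous_on_compose2[OF cont\<phi>]) (use r in \<open>auto intro!: continuous_intros\<close>)
  have cont2: "continuous_on A (\<lambda>(s, t). K s t * u t)" for A
    unfolding case_prod_unfold K_def
    by (intro continuous_intros continuous_on_poisson_kernel continuous_on_compose2[OF cont\<phi>']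
          continuous_on_compose2[OF contu]) (use bd' in auto)
  have contK: "continuous_on A (\<lambda>t. K s t * u t)" for A s
    unfolding K_def by (intro continuous_intros continuous_on_poisson_kernel contu) (use bd' in auto)
  have "2 * pi * integral {0..2 * pi} (\<lambda>s. cmod (f (\<phi> (complex_of_real r * cis s))) powr p)
       = integral {0..2 * pi} (\<lambda>s. 2 * pi * cmod (f (\<phi> (complex_of_real r * cis s))) powr p)"
    by simp
  also have "\<dots> \<le> integral {0..2 * pi} (\<lambda>s. integral {0..2 * pi} (\<lambda>t. K s t * u t))"
  proof (rule integral_le)
    have "(f \<circ> \<phi>) holomorphic_on \<bbbD>"
      by (rule holomorphic_on_compose_gen[OF \<phi>(1) f]) (use \<phi>(2) in auto)
    hence "continuous_on {0..2 * pi} (\<lambda>s. cmod ((f \<circ> \<phi>) (complex_of_real r * cis s)) powr p)"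
      using p r by (intro continuous_on_norm_powr_disk) (auto simp: o_def)
    hence "continuous_on {0..2 * pi} (\<lambda>s. 2 * pi * cmod (f (\<phi> (complex_of_real r * cis s))) powr p)"
      by (intro continuous_on_mult continuous_on_const) (simp add: o_def)
    thus "(\<lambda>s. 2 * pi * cmod (f (\<phi> (complex_of_real r * cis s))) powr p) integrable_on {0..2 * pi}"
      by (rule integrable_continuous_real)
    have "continuous_on (cbox 0 (2 * pi)) (\<lambda>s. integral (cbox 0 (2 * pi)) (\<lambda>t. K s t * u t))"
      by (rule integral_continuous_on_param) (rule cont2)
    thus "(\<lambda>s. integral {0..2 * pi} (\<lambda>t. K s t * u t)) integrable_on {0..2 * pi}"
      by (intro integrable_continuous_real) simp
  qed (use R(4)[OF bd'] in \<open>simp add: K_def u_def\<close>)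
  also have "\<dots> = integral {0..2 * pi} (\<lambda>t. integral {0..2 * pi} (\<lambda>s. K s t * u t))"
    using integral_swap_continuous[OF cont2, of 0 "2 * pi" 0 "2 * pi"] by (simp only: cbox_interval)
  also have "\<dots> = integral {0..2 * pi} (\<lambda>t. 2 * pi * poisson_kernel R t (\<phi> 0) * u t)"
  proof -
    have "integral {0..2 * pi} (\<lambda>s. K s t * u t) = 2 * pi * poisson_kernel R t (\<phi> 0) * u t" for t
      using poisson_kernel_mean[OF cont\<phi> hol\<phi> r(1) bd, of t]
      unfolding K_def integral_mult_left by (simp add: integral_unique)
    thus ?thesis by (simp only:)
  qed
  also have "\<dots> \<le> integral {0..2 * pi} (\<lambda>t. 2 * pi * C * u t)"
  proof (rule integral_le)
    show "(\<lambda>t. 2 * pi * poisson_kernel R t (\<phi> 0) * u t) integrable_on {0..2 * pi}"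
      by (intro integrable_continuous_real continuous_intros continuous_on_poisson_kernel contu bd0)
    show "(\<lambda>t. 2 * pi * C * u t) integrable_on {0..2 * pi}"
      by (intro integrable_continuous_real continuous_intros contu)
    show "2 * pi * poisson_kernel R t (\<phi> 0) * u t \<le> 2 * pi * C * u t" for t
      using poisson_kernel_le[OF bd0, of t]
      by (intro mult_right_mono mult_left_mono) (auto simp: C_def u_def)
  qed
  also have "\<dots> = 2 * pi * (C * integral {0..2 * pi} u)"
    by (simp add: mult.assoc)
  finally have "integral {0..2 * pi} (\<lambda>s. cmod (f (\<phi> (complex_of_real r * cis s))) powr p)
                  \<le> C * integral {0..2 * pi} u" by simp
  hence "1 / (2 * pi) * integral {0..2 * pi} (\<lambda>s. cmod (f (\<phi> (complex_of_real r * cis s))) powr p)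
                  \<le> 1 / (2 * pi) * (C * integral {0..2 * pi} u)"
    by (intro mult_left_mono) auto
  thus ?thesis using R bd0
    by (intro that[of R]) (auto simp: circle_mean_def u_def C_def mult_ac)
qed

lemma hardy_space_iff:
  "f \<in> hardy_space p \<longleftrightarrow> f holomorphic_on \<bbbD> \<and>
     (\<exists>C. \<forall>r. 0 < r \<longrightarrow> r < 1 \<longrightarrow> circle_mean (\<lambda>z. cmod (f z) powr p) r \<le> C)"
proof -
  have eq: "(\<lambda>r. 1 / (2 * pi) * integral {0..2 * pi} (\<lambda>t. cmod (f (complex_of_real r * cis t)) powr p))
          = circle_mean (\<lambda>z. cmod (f z) powr p)"
    by (simp add: fun_eq_iff circle_mean_def)
  have "(\<forall>x\<in>{0<..<1}. g x \<le> C) \<longleftrightarrow> (\<forall>r. 0 < r \<longrightarrow> r < 1 \<longrightarrow> g r \<le> C)" for C and g :: "real \<Rightarrow> real"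
    by auto
  thus ?thesis unfolding hardy_space_def mem_Collect_eq eq bdd_above_def
    by (simp only: ball_simps)
qed

text \<open>The constant in Littlewood's inequality depends on $R$, but stays bounded for $R > (1 + |\<phi>(0)|) / 2$.\<close>
lemma hardy_space_compose:
  assumes f: "f \<in> hardy_space p" and \<phi>: "\<phi> holomorphic_on \<bbbD>" "\<phi> ` \<bbbD> \<subseteq> \<bbbD>" and p: "p > 0"
  shows "(\<lambda>z. f (\<phi> z)) \<in> hardy_space p"
proof -
  obtain C where holf: "f holomorphic_on \<bbbD>"
    and C: "\<And>r. 0 < r \<Longrightarrow> r < 1 \<Longrightarrow> circle_mean (\<lambda>z. cmod (f z) powr p) r \<le> C"
    using f unfolding hardy_space_iff by blast
  define b where "b = cmod (\<phi> 0)"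
  have b: "0 \<le> b" "b < 1" using \<phi>(2)[THEN subsetD, OF imageI[of 0]] by (auto simp: b_def)
  have "0 \<le> circle_mean (\<lambda>z. cmod (f z) powr p) (1/2)"
    unfolding circle_mean_def
    by (intro mult_nonneg_nonneg integral_nonneg integrable_continuous_real
        continuous_on_norm_powr_disk holf p) auto
  hence C0: "C \<ge> 0" using C[of "1/2"] by simp
  have "circle_mean (\<lambda>z. cmod (f (\<phi> z)) powr p) r \<le> 2 / ((1 - b) / 2) * C" if r: "0 < r" "r < 1" for r
  proof -
    obtain R where R: "(1 + b) / 2 < R" "b < R" "R < 1"
      "circle_mean (\<lambda>z. cmod (f (\<phi> z)) powr p) r
         \<le> (R + b) / (R - b) * circle_mean (\<lambda>z. cmod (f z) powr p) R"
      unfolding b_def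
      by (rule littlewood_subordination[OF holf \<phi> p r, of "(1 + b) / 2"]) (use b in \<open>auto simp: b_def\<close>)
    have "(R + b) / (R - b) \<le> 2 / ((1 - b) / 2)"
      by (rule frac_le) (use R b in auto)
    moreover have "circle_mean (\<lambda>z. cmod (f z) powr p) R \<le> C" using C[of R] R b by auto
    moreover have "0 \<le> (R + b) / (R - b)" using R b by auto
    ultimately have "(R + b) / (R - b) * circle_mean (\<lambda>z. cmod (f z) powr p) R
       \<le> 2 / ((1 - b) / 2) * C" using C0
      by (smt (verit) mult_left_mono mult_right_mono)
    with R(4) show ?thesis by linarith
  qed
  moreover have "(\<lambda>z. f (\<phi> z)) holomorphic_on \<bbbD>"
    using holomorphic_on_compose_gen[OF \<phi>(1) holf \<phi>(2)] by (simp add: o_def)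
  ultimately show ?thesis unfolding hardy_space_iff by blast
qed

text \<open>Subordination for the identity map: a weak form of the monotonicity of the means.\<close>
lemma circle_mean_le_larger_radius:
  fixes p :: real
  assumes "f holomorphic_on \<bbbD>" "p > 0" "0 < r" "r < 1" "\<rho> < 1"
  obtains R where "\<rho> < R" "0 < R" "R < 1"
    "circle_mean (\<lambda>z. cmod (f z) powr p) r \<le> circle_mean (\<lambda>z. cmod (f z) powr p) R"
  by (rule littlewood_subordination[of f "\<lambda>z. z" p r \<rho>]) (use assms in auto)

lemma hardy_space_bounded_mult:
  assumes f: "f \<in> hardy_space p" and b: "b holomorphic_on \<bbbD>" "\<And>z. z \<in> \<bbbD> \<Longrightarrow> cmod (b z) \<le> 1"
    and p: "p > 0"
  shows "(\<lambda>z. b z * f z) \<in> hardy_space p"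
proof -
  obtain C where holf: "f holomorphic_on \<bbbD>"
    and C: "\<And>r. 0 < r \<Longrightarrow> r < 1 \<Longrightarrow> circle_mean (\<lambda>z. cmod (f z) powr p) r \<le> C"
    using f unfolding hardy_space_iff by blast
  have hol: "(\<lambda>z. b z * f z) holomorphic_on \<bbbD>" by (intro holomorphic_intros b holf)
  have "circle_mean (\<lambda>z. cmod (b z * f z) powr p) r \<le> C" if r: "0 < r" "r < 1" for r
  proof -
    have "circle_mean (\<lambda>z. cmod (b z * f z) powr p) r \<le> 1 * circle_mean (\<lambda>z. cmod (f z) powr p) r"
    proof (rule circle_mean_mono)
      fix t :: real
      have "cmod (b (of_real r * cis t) * f (of_real r * cis t)) \<le> 1 * cmod (f (of_real r * cis t))"
        unfolding norm_mult using r by (intro mult_right_mono b) auto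
      thus "cmod (b (of_real r * cis t) * f (of_real r * cis t)) powr p
              \<le> 1 * cmod (f (of_real r * cis t)) powr p"
        using p by (simp add: powr_mono2)
    qed (use hol holf p r in \<open>auto intro!: continuous_on_norm_powr_disk[where f = "\<lambda>z. b z * f z"] continuous_on_norm_powr_disk\<close>)
    with C[OF r] show ?thesis by simp
  qed
  with hol show ?thesis unfolding hardy_space_iff by blast
qed

section \<open>Blaschke products\<close>

abbreviation normalized_factor :: "complex \<Rightarrow> complex \<Rightarrow> complex"
  where "normalized_factor a z \<equiv> blaschke_normalizer a * blaschke_factor a z"

lemma blaschke_denominator_ne:
  assumes "cmod a < 1" "cmod z \<le> 1"
  shows "1 - cnj a * z \<noteq> 0"
  using reflected_factor(1)[of 1 a z] assms by simp

lemma norm_blaschke_normalizer [simp]: "cmod (blaschke_normalizer a) = 1"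
  by (simp add: blaschke_normalizer_def norm_divide)

lemma norm_normalized_factor_le:
  assumes "cmod a < 1" "cmod z \<le> 1"
  shows "cmod (normalized_factor a z) \<le> 1"
  using reflected_factor(2)[of 1 a z] blaschke_denominator_ne[OF assms] assms
  by (simp add: blaschke_factor_def norm_mult norm_divide norm_minus_commute)

lemma norm_normalized_factor_eq:
  assumes "cmod a < 1" "cmod z = 1"
  shows "cmod (normalized_factor a z) = 1"
  using reflected_factor(3)[of 1 a z] blaschke_denominator_ne[of a z] assms
  by (auto simp add: blaschke_factor_def norm_mult norm_divide norm_minus_commute)

lemma normalized_factor_eq_0_iff:
  assumes "cmod a < 1" "cmod z < 1"
  shows "normalized_factor a z = 0 \<longleftrightarrow> z = a"
proof -
  have "blaschke_normalizer a \<noteq> 0" by (metis norm_blaschke_normalizer norm_zero zero_neq_one)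
  thus ?thesis
    using blaschke_denominator_ne[of a z] assms by (auto simp: blaschke_factor_def)
qed

lemma continuous_on_normalized_factor:
  assumes "cmod a < 1"
  shows "continuous_on (cball 0 1) (normalized_factor a)"
  unfolding blaschke_factor_def
  by (intro continuous_intros) (use blaschke_denominator_ne[OF assms] in auto)

lemma holomorphic_on_normalized_factor:
  assumes "cmod a < 1"
  shows "normalized_factor a holomorphic_on \<bbbD>"
  unfolding blaschke_factor_def
  by (intro holomorphic_intros) (use blaschke_denominator_ne[OF assms] in auto)

text \<open>The reason why $\<Sum> m_i (1 - |a_i|) < \<infinity>$ makes the product converge. The normalizer $|a| / a$ makes the factor
positive at 0, and
$1 - b_a(z) = (1 - |a|)(a + |a| z) / (a (1 - \<open>cnj a\<close> \<cdot> z))$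
for the normalized factor $b_a$.\<close>
lemma norm_one_minus_normalized_factor:
  assumes a: "cmod a < 1" and z: "cmod z \<le> r" and r: "r < 1"
  shows "cmod (1 - normalized_factor a z) \<le> 2 / (1 - r) * (1 - cmod a)"
proof (cases "a = 0")
  case True
  have "cmod (1 - z) \<le> 2" using norm_triangle_ineq4[of 1 z] z r by simp
  moreover have "2 \<le> 2 / (1 - r)" using z r by (simp add: field_simps) (metis norm_ge_zero order_trans)
  moreover have "normalized_factor a z = z"
    using True by (simp add: blaschke_normalizer_def blaschke_factor_def)
  ultimately show ?thesis using True by (simp only: norm_zero) simp
next
  case False
  have nz: "1 - cnj a * z \<noteq> 0" using blaschke_denominator_ne[of a z] a z r by simp
  have sq: "a * cnj a = complex_of_real (cmod a) * complex_of_real (cmod a)"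
    using complex_norm_square[of a] by (simp add: power2_eq_square)
  have "a * (1 - cnj a * z) - of_real (cmod a) * (a - z)
       = (1 - of_real (cmod a)) * (a + of_real (cmod a) * z)
          + (of_real (cmod a) * of_real (cmod a) - a * cnj a) * z"
    by (simp add: algebra_simps)
  also have "\<dots> = of_real (1 - cmod a) * (a + of_real (cmod a) * z)"
    by (simp add: sq)
  finally have num: "a * (1 - cnj a * z) - of_real (cmod a) * (a - z)
       = of_real (1 - cmod a) * (a + of_real (cmod a) * z)" .
  have "1 - normalized_factor a z
      = (a * (1 - cnj a * z) - of_real (cmod a) * (a - z)) / (a * (1 - cnj a * z))"
    using False nz
    by (subst diff_divide_distrib) (simp add: blaschke_normalizer_def blaschke_factor_def)
  hence "cmod (1 - normalized_factor a z)
      = (1 - cmod a) * cmod (a + of_real (cmod a) * z) / (cmod a * cmod (1 - cnj a * z))"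
    using a by (simp only: num norm_divide norm_mult norm_of_real)
  also have "\<dots> \<le> (1 - cmod a) * (2 * cmod a) / (cmod a * (1 - r))"
  proof (rule frac_le)
    have "cmod (a + of_real (cmod a) * z) \<le> cmod a + cmod a * cmod z"
      using norm_triangle_ineq[of a "of_real (cmod a) * z"] by (simp add: norm_mult)
    also have "\<dots> \<le> cmod a + cmod a * 1" using z r by (intro add_left_mono mult_left_mono) auto
    finally show "(1 - cmod a) * cmod (a + of_real (cmod a) * z) \<le> (1 - cmod a) * (2 * cmod a)"
      using a by (intro mult_left_mono) auto
    have "cmod (cnj a * z) \<le> 1 * r" unfolding norm_mult using a z by (intro mult_mono) auto
    hence "1 - r \<le> cmod (1 - cnj a * z)" using norm_triangle_ineq2[of 1 "cnj a * z"] by simp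
    thus "cmod a * (1 - r) \<le> cmod a * cmod (1 - cnj a * z)" by (intro mult_left_mono) auto
  qed (use a r False in auto)
  also have "\<dots> = 2 / (1 - r) * (1 - cmod a)" using False r by (simp add: field_simps)
  finally show ?thesis .
qed

locale blaschke_data =
  fixes I :: "nat set" and a :: "nat \<Rightarrow> complex" and m :: "nat \<Rightarrow> nat"
  assumes zeros_in_disk: "\<And>i. i \<in> I \<Longrightarrow> cmod (a i) < 1"
    and blaschke_condition: "(\<lambda>i. real (m i) * (1 - cmod (a i))) summable_on I"
begin

definition blaschke_term :: "nat \<Rightarrow> complex \<Rightarrow> complex"
  where "blaschke_term i z = (if i \<in> I then (normalized_factor (a i) z) ^ m i else 1)"

definition weight :: "nat \<Rightarrow> real"
  where "weight i = (if i \<in> I then real (m i) * (1 - cmod (a i)) else 0)"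

lemma blaschke_product_eq: "blaschke_product \<gamma> I a m z = \<gamma> * (\<Prod>i. blaschke_term i z)"
  by (simp add: blaschke_product_def blaschke_term_def)

lemma weight_nonneg: "weight i \<ge> 0"
  using zeros_in_disk[of i] by (auto simp: weight_def)

lemma summable_weight: "summable weight"
proof -
  have "weight summable_on UNIV \<longleftrightarrow> (\<lambda>i. real (m i) * (1 - cmod (a i))) summable_on I"
    by (rule summable_on_cong_neutral) (auto simp: weight_def)
  thus ?thesis using blaschke_condition summable_on_UNIV_nonneg_real_iff[of weight] weight_nonneg
    by blast
qed

lemma norm_blaschke_term_le: "cmod z \<le> 1 \<Longrightarrow> cmod (blaschke_term i z) \<le> 1"
  using norm_normalized_factor_le[OF zeros_in_disk, of i z]
  unfolding blaschke_term_def by (auto simp: norm_power intro!: power_le_one)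

lemma norm_blaschke_term_eq: "cmod z = 1 \<Longrightarrow> cmod (blaschke_term i z) = 1"
  using norm_normalized_factor_eq[OF zeros_in_disk, of i z]
  unfolding blaschke_term_def by (auto simp: norm_power)

lemma continuous_on_blaschke_term: "continuous_on (cball 0 1) (blaschke_term i)"
  unfolding blaschke_term_def
  by (cases "i \<in> I") (auto intro!: continuous_on_power continuous_on_normalized_factor zeros_in_disk)

lemma holomorphic_on_blaschke_term: "blaschke_term i holomorphic_on \<bbbD>"
  unfolding blaschke_term_def
  by (cases "i \<in> I") (auto intro!: holomorphic_on_power holomorphic_on_normalized_factor zeros_in_disk)

lemma norm_blaschke_term_minus_1:
  assumes "cmod z \<le> r" "r < 1"
  shows "cmod (blaschke_term i z - 1) \<le> 2 / (1 - r) * weight i"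
proof (cases "i \<in> I")
  case True
  have "cmod (1 ^ m i - normalized_factor (a i) z ^ m i)
          \<le> m i * cmod (1 - normalized_factor (a i) z)"
    using assms by (intro norm_power_diff norm_normalized_factor_le zeros_in_disk True) auto
  also have "\<dots> \<le> m i * (2 / (1 - r) * (1 - cmod (a i)))"
    using assms by (intro mult_left_mono norm_one_minus_normalized_factor zeros_in_disk True) auto
  finally show ?thesis using True
    by (simp add: blaschke_term_def weight_def norm_minus_commute mult_ac)
qed (simp add: blaschke_term_def weight_def)

lemma convergent_prod_blaschke_term:
  assumes "z \<in> \<bbbD>"
  shows "convergent_prod (\<lambda>i. blaschke_term i z)"
proof -
  have "summable (\<lambda>i. 2 / (1 - cmod z) * weight i)"
    by (rule summable_mult[OF summable_weight])
  hence "summable (\<lambda>i. cmod (blaschke_term i z - 1))"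
    by (rule summable_comparison_test'[where N = 0])
      (use norm_blaschke_term_minus_1[of z "cmod z"] assms in auto)
  thus ?thesis
    by (intro abs_convergent_prod_imp_convergent_prod summable_imp_abs_convergent_prod)
qed

lemma blaschke_partial_products_tendsto:
  assumes "z \<in> \<bbbD>"
  shows "(\<lambda>n. \<Prod>i<n. blaschke_term i z) \<longlonglongrightarrow> blaschke_product 1 I a m z"
  using has_prod_imp_tendsto'[OF convergent_prod_has_prod[OF convergent_prod_blaschke_term[OF assms]]]
  by (simp add: blaschke_product_eq)

lemma norm_blaschke_product_le:
  assumes "z \<in> \<bbbD>" "cmod \<gamma> = 1"
  shows "cmod (blaschke_product \<gamma> I a m z) \<le> 1"
proof -
  have "cmod (blaschke_product 1 I a m z) \<le> 1"
  proof (rule Lim_bounded)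
    show "(\<lambda>n. cmod (\<Prod>i<n. blaschke_term i z)) \<longlonglongrightarrow> cmod (blaschke_product 1 I a m z)"
      by (intro tendsto_norm blaschke_partial_products_tendsto assms)
    show "\<forall>n\<ge>0. cmod (\<Prod>i<n. blaschke_term i z) \<le> 1"
      using assms by (auto simp: prod_norm[symmetric] intro!: prod_le_1 norm_blaschke_term_le)
  qed
  thus ?thesis using assms by (simp add: blaschke_product_def norm_mult)
qed

text \<open>Since all factors have modulus at most 1, the distance of the product from 1 is at most the sum of
the distances of its factors from 1.\<close>
lemma norm_one_minus_blaschke_product:
  assumes "cmod z \<le> r" "r < 1"
  shows "cmod (blaschke_product 1 I a m z - 1) \<le> 2 / (1 - r) * (\<Sum>i. weight i)"
proof (rule Lim_bounded)
  have "z \<in> \<bbbD>" using assms by simp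
  show "(\<lambda>n. cmod ((\<Prod>i<n. blaschke_term i z) - 1)) \<longlonglongrightarrow> cmod (blaschke_product 1 I a m z - 1)"
    by (intro tendsto_intros blaschke_partial_products_tendsto) fact
  have "cmod ((\<Prod>i<n. blaschke_term i z) - 1) \<le> 2 / (1 - r) * (\<Sum>i. weight i)" for n
  proof -
    have "cmod ((\<Prod>i<n. blaschke_term i z) - (\<Prod>i<n. 1)) \<le> (\<Sum>i<n. cmod (blaschke_term i z - 1))"
      using assms by (intro norm_prod_diff norm_blaschke_term_le) auto
    also have "\<dots> \<le> (\<Sum>i<n. 2 / (1 - r) * weight i)"
      by (intro sum_mono norm_blaschke_term_minus_1 assms)
    also have "\<dots> = 2 / (1 - r) * (\<Sum>i<n. weight i)" by (simp add: sum_distrib_left)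
    also have "\<dots> \<le> 2 / (1 - r) * (\<Sum>i. weight i)"
      using assms by (intro mult_left_mono sum_le_suminf summable_weight) (auto simp: weight_nonneg)
    finally show ?thesis by simp
  qed
  thus "\<forall>n\<ge>0. cmod ((\<Prod>i<n. blaschke_term i z) - 1) \<le> 2 / (1 - r) * (\<Sum>i. weight i)" by blast
qed

lemma holomorphic_on_blaschke_product: "blaschke_product \<gamma> I a m holomorphic_on \<bbbD>"
proof -
  have "blaschke_product 1 I a m holomorphic_on \<bbbD>"
  proof (rule holomorphic_uniform_sequence)
    show "(\<lambda>z. \<Prod>i<n. blaschke_term i z) holomorphic_on \<bbbD>" for n
      by (intro holomorphic_intros holomorphic_on_blaschke_term)
    fix x assume x: "x \<in> \<bbbD>"
    then obtain d where d: "d > 0" "cball x d \<subseteq> \<bbbD>"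
      by (metis open_ball open_contains_cball)
    obtain r where r: "r < 1" "\<And>z. z \<in> cball x d \<Longrightarrow> cmod z \<le> r"
    proof -
      have "\<exists>w\<in>cball x d. \<forall>y\<in>cball x d. cmod y \<le> cmod w"
        using d by (intro continuous_attains_sup continuous_intros) auto
      thus ?thesis using that d by fastforce
    qed
    have "uniformly_convergent_on (cball x d) (\<lambda>N z. \<Prod>n<N. blaschke_term n z)"
    proof (rule uniformly_convergent_on_prod')
      show "continuous_on (cball x d) (blaschke_term n)" for n
        using d by (intro continuous_on_subset[OF continuous_on_blaschke_term]) force
      show "uniformly_convergent_on (cball x d) (\<lambda>N z. \<Sum>n<N. cmod (blaschke_term n z - 1))"
        by (rule Weierstrass_m_test'[OF _ summable_mult[OF summable_weight, of "2 / (1 - r)"]])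
          (use norm_blaschke_term_minus_1 r in auto)
    qed auto
    then obtain l where l: "uniform_limit (cball x d) (\<lambda>N z. \<Prod>n<N. blaschke_term n z) l sequentially"
      unfolding uniformly_convergent_on_def by blast
    have "l z = blaschke_product 1 I a m z" if "z \<in> cball x d" for z
      using LIMSEQ_unique[OF tendsto_uniform_limitI[OF l that] blaschke_partial_products_tendsto] that d
      by blast
    hence "uniform_limit (cball x d) (\<lambda>N z. \<Prod>n<N. blaschke_term n z) (blaschke_product 1 I a m) sequentially"
      using l by (subst uniform_limit_cong'[where i = l]) auto
    thus "\<exists>d>0. cball x d \<subseteq> \<bbbD> \<and> uniform_limit (cball x d) (\<lambda>N z. \<Prod>n<N. blaschke_term n z)
            (blaschke_product 1 I a m) sequentially" using d by blast
  qed auto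
  hence "(\<lambda>z. \<gamma> * blaschke_product 1 I a m z) holomorphic_on \<bbbD>" by (intro holomorphic_intros)
  thus ?thesis by (simp add: blaschke_product_def[abs_def])
qed

lemma blaschke_product_eq_0_iff:
  assumes "z \<in> \<bbbD>" "\<gamma> \<noteq> 0"
  shows "blaschke_product \<gamma> I a m z = 0 \<longleftrightarrow> (\<exists>i\<in>I. z = a i \<and> m i \<noteq> 0)"
proof -
  have "(\<lambda>i. blaschke_term i z) has_prod (\<Prod>i. blaschke_term i z)"
    using convergent_prod_blaschke_term[OF assms(1)] by blast
  hence "(\<Prod>i. blaschke_term i z) = 0 \<longleftrightarrow> 0 \<in> range (\<lambda>i. blaschke_term i z)"
    by (rule has_prod_eq_0_iff)
  also have "\<dots> \<longleftrightarrow> (\<exists>i\<in>I. z = a i \<and> m i \<noteq> 0)"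
    using normalized_factor_eq_0_iff[OF zeros_in_disk] assms(1)
    by (auto simp: blaschke_term_def image_iff split: if_splits)
  finally show ?thesis using assms(2) by (simp add: blaschke_product_eq)
qed

lemma blaschke_data_subset:
  assumes "J \<subseteq> I" shows "blaschke_data J a m"
  using assms zeros_in_disk summable_on_subset_banach[OF blaschke_condition assms]
  by unfold_locales auto

text \<open>Used with a single index to isolate one zero, and with an initial segment to separate a finite
product from a tail.\<close>
lemma blaschke_product_split:
  assumes "J \<subseteq> I" "z \<in> \<bbbD>"
  shows "blaschke_product \<gamma> I a m z = blaschke_product \<gamma> J a m z * blaschke_product 1 (I - J) a m z"
proof -
  interpret J: blaschke_data J a m by (rule blaschke_data_subset) fact
  interpret K: blaschke_data "I - J" a m by (rule blaschke_data_subset) simp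
  have "(\<Prod>i. J.blaschke_term i z) * (\<Prod>i. K.blaschke_term i z)
      = (\<Prod>i. J.blaschke_term i z * K.blaschke_term i z)"
    by (intro prodinf_mult J.convergent_prod_blaschke_term K.convergent_prod_blaschke_term assms)
  also have "(\<lambda>i. J.blaschke_term i z * K.blaschke_term i z) = (\<lambda>i. blaschke_term i z)"
    using assms(1) by (auto simp: fun_eq_iff J.blaschke_term_def K.blaschke_term_def blaschke_term_def)
  finally show ?thesis by (simp add: blaschke_product_eq J.blaschke_product_eq K.blaschke_product_eq)
qed

text \<open>The weights of a far tail have a small sum, so on a fixed smaller disk the tail product is close to 1.\<close>
lemma ex_tail_near_1:
  assumes r: "0 < r" "r < 1"
  obtains n where "\<And>z. cmod z \<le> r \<Longrightarrow> cmod (blaschke_product 1 (I - {..<n}) a m z) \<ge> 1 / 2"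
proof -
  have "(\<lambda>n. \<Sum>i. weight (i + n)) \<longlonglongrightarrow> 0"
    using suminf_exist_split2[OF summable_weight] by simp
  \<comment> \<open>The bound 2 / (1 - r) times (1 - r) / 4 is 1 / 2.\<close>
  moreover have "(1 - r) / 4 > 0" using r by simp
  ultimately have "\<forall>\<^sub>F n in sequentially. (\<Sum>i. weight (i + n)) < (1 - r) / 4"
    by (rule order_tendstoD)
  then obtain n where n: "(\<Sum>i. weight (i + n)) < (1 - r) / 4"
    by (auto simp: eventually_sequentially)
  interpret K: blaschke_data "I - {..<n}" a m by (rule blaschke_data_subset) auto
  have "(\<Sum>i. K.weight i) = (\<Sum>i. K.weight (i + n)) + (\<Sum>i<n. K.weight i)"
    by (rule suminf_split_initial_segment[OF K.summable_weight])
  also have "(\<Sum>i<n. K.weight i) = 0" by (intro sum.neutral) (auto simp: K.weight_def)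
  also have "(\<lambda>i. K.weight (i + n)) = (\<lambda>i. weight (i + n))"
    by (auto simp: fun_eq_iff K.weight_def weight_def)
  finally have *: "(\<Sum>i. K.weight i) < (1 - r) / 4" using n by simp
  show ?thesis
  proof (rule that[of n])
    fix z assume z: "cmod z \<le> r"
    have "cmod (blaschke_product 1 (I - {..<n}) a m z - 1) \<le> 2 / (1 - r) * (\<Sum>i. K.weight i)"
      by (rule K.norm_one_minus_blaschke_product[OF z r(2)])
    also have "\<dots> \<le> 2 / (1 - r) * ((1 - r) / 4)"
      using * r by (intro mult_left_mono) auto
    also have "\<dots> = 1 / 2" using r by (simp add: field_simps)
    finally show "cmod (blaschke_product 1 (I - {..<n}) a m z) \<ge> 1 / 2"
      using norm_triangle_ineq2[of 1 "1 - blaschke_product 1 (I - {..<n}) a m z"]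
      by (simp add: norm_minus_commute)
  qed
qed

lemma finite_blaschke_product_eq:
  assumes "finite I"
  shows "blaschke_product \<gamma> I a m z = \<gamma> * (\<Prod>i\<in>I. blaschke_term i z)"
  unfolding blaschke_product_eq
  by (subst prodinf_finite[OF assms]) (auto simp: blaschke_term_def)

text \<open>A finite Blaschke product is continuous on the closed disk and unimodular on the circle, so the
compact set where its modulus is at most $1/2$ stays away from the circle.\<close>
lemma ex_finite_blaschke_product_ge_half:
  assumes "finite I" "cmod \<gamma> = 1"
  obtains \<rho> where "\<rho> < 1" "\<And>z. \<rho> < cmod z \<Longrightarrow> cmod z < 1 \<Longrightarrow> cmod (blaschke_product \<gamma> I a m z) \<ge> 1 / 2"
proof -
  define P where "P = (\<lambda>z. \<Prod>i\<in>I. blaschke_term i z)"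
  have eq: "cmod (blaschke_product \<gamma> I a m z) = cmod (P z)" for z
    using assms by (simp add: finite_blaschke_product_eq P_def norm_mult)
  have cont: "continuous_on (cball 0 1) P"
    unfolding P_def by (intro continuous_intros continuous_on_blaschke_term)
  define K where "K = {z \<in> cball 0 1. cmod (P z) \<le> 1 / 2}"
  have "closed (cball 0 1 \<inter> (\<lambda>z. cmod (P z)) -` {..1 / 2})"
    by (intro continuous_closed_preimage continuous_on_norm cont) auto
  also have "cball 0 1 \<inter> (\<lambda>z. cmod (P z)) -` {..1 / 2} = K" by (auto simp: K_def)
  finally have "closed K" .
  hence "compact K" by (auto simp: K_def compact_eq_bounded_closed intro: bounded_subset[OF bounded_cball[of 0 1]])
  have P1: "cmod (P z) = 1" if "cmod z = 1" for z
    using that by (auto simp: P_def prod_norm[symmetric] norm_blaschke_term_eq intro!: prod.neutral)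
  have K: "cmod z < 1" if "z \<in> K" for z
    using that P1[of z] by (force simp: K_def)
  show ?thesis
  proof (cases "K = {}")
    case True
    have "cmod (P z) \<ge> 1 / 2" if "cmod z < 1" for z
    proof -
      have "z \<notin> K" using True by simp
      thus ?thesis using that by (simp add: K_def)
    qed
    thus ?thesis using that[of 0] unfolding eq by simp
  next
    case False
    then obtain w where w: "w \<in> K" "\<And>z. z \<in> K \<Longrightarrow> cmod z \<le> cmod w"
      using continuous_attains_sup[OF \<open>compact K\<close> False, of cmod] by (auto intro: continuous_intros)
    have "cmod (P z) \<ge> 1 / 2" if "cmod w < cmod z" "cmod z < 1" for z
      using w(2)[of z] that by (force simp: K_def)
    thus ?thesis using that[of "cmod w"] K[OF w(1)] unfolding eq by blast
  qed
qed

end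

section \<open>Division by a Blaschke product\<close>

context blaschke_data
begin

text \<open>Split $B = B_n T_n$ into a finite product and a tail, and put $G = T_n h$, so $g = B_n G$. On the circle of radius
$r$ the tail is at least $1/2$, so $h$ is controlled by $G$. The means of $G$ pass to a larger radius $R$, and near the
unit circle $|B_n| \<ge> 1/2$, so there $G$ is controlled by $g$. Both steps cost a factor $2^p$, independently
of $n$ and $r$.\<close>
lemma hardy_space_divide:
  fixes p :: real
  assumes g: "g \<in> hardy_space p" and h: "h holomorphic_on \<bbbD>"
    and eq: "\<And>z. z \<in> \<bbbD> \<Longrightarrow> g z = blaschke_product \<gamma> I a m z * h z"
    and \<gamma>: "cmod \<gamma> = 1" and p: "p > 0"
  shows "h \<in> hardy_space p"
proof -
  obtain C where holg: "g holomorphic_on \<bbbD>"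
    and C: "\<And>r. 0 < r \<Longrightarrow> r < 1 \<Longrightarrow> circle_mean (\<lambda>z. cmod (g z) powr p) r \<le> C"
    using g unfolding hardy_space_iff by blast
  have "circle_mean (\<lambda>z. cmod (h z) powr p) r \<le> 2 powr p * (2 powr p * C)" if r: "0 < r" "r < 1" for r
  proof -
    obtain n where n: "\<And>z. cmod z \<le> r \<Longrightarrow> cmod (blaschke_product 1 (I - {..<n}) a m z) \<ge> 1 / 2"
      using ex_tail_near_1[OF r] by blast
    define J where "J = I \<inter> {..<n}"
    define T where "T = blaschke_product 1 (I - {..<n}) a m"
    have IJ: "I - J = I - {..<n}" by (auto simp: J_def)
    interpret J: blaschke_data J a m by (rule blaschke_data_subset) (simp add: J_def)
    interpret K: blaschke_data "I - {..<n}" a m by (rule blaschke_data_subset) auto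
    define G where "G = (\<lambda>z. T z * h z)"
    have holG: "G holomorphic_on \<bbbD>" unfolding G_def T_def
      by (intro holomorphic_intros K.holomorphic_on_blaschke_product h)
    have gG: "g z = blaschke_product \<gamma> J a m z * G z" if "z \<in> \<bbbD>" for z
      using eq[OF that] blaschke_product_split[of J z \<gamma>] that IJ by (simp add: J_def G_def T_def)
    obtain \<rho> where \<rho>: "\<rho> < 1"
      "\<And>z. \<rho> < cmod z \<Longrightarrow> cmod z < 1 \<Longrightarrow> cmod (blaschke_product \<gamma> J a m z) \<ge> 1 / 2"
      using J.ex_finite_blaschke_product_ge_half[OF _ \<gamma>] by (auto simp: J_def)
    obtain R where R: "\<rho> < R" "0 < R" "R < 1"
      "circle_mean (\<lambda>z. cmod (G z) powr p) r \<le> circle_mean (\<lambda>z. cmod (G z) powr p) R"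
      using circle_mean_le_larger_radius[OF holG p r \<rho>(1)] by metis
    have dbl: "x powr p \<le> 2 powr p * y powr p" if "0 \<le> x" "x \<le> 2 * y" for x y :: real
      using powr_mono2[of p x "2 * y"] that p by (simp add: powr_mult)
    have "circle_mean (\<lambda>z. cmod (h z) powr p) r \<le> 2 powr p * circle_mean (\<lambda>z. cmod (G z) powr p) r"
    proof (intro circle_mean_mono dbl)
      fix t
      have "1 / 2 * cmod (h (of_real r * cis t)) \<le> cmod (G (of_real r * cis t))"
        unfolding G_def norm_mult T_def by (intro mult_right_mono n) (use r in auto)
      thus "cmod (h (of_real r * cis t)) \<le> 2 * cmod (G (of_real r * cis t))" by simp
    qed (use r p in \<open>auto intro!: continuous_on_norm_powr_disk h holG\<close>)
    also have "\<dots> \<le> 2 powr p * circle_mean (\<lambda>z. cmod (G z) powr p) R"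
      using R(4) by (intro mult_left_mono) auto
    also have "circle_mean (\<lambda>z. cmod (G z) powr p) R \<le> 2 powr p * circle_mean (\<lambda>z. cmod (g z) powr p) R"
    proof (intro circle_mean_mono dbl)
      fix t
      have "1 / 2 \<le> cmod (blaschke_product \<gamma> J a m (of_real R * cis t))"
        by (rule \<rho>(2)) (use R in auto)
      hence "1 / 2 * cmod (G (of_real R * cis t))
          \<le> cmod (blaschke_product \<gamma> J a m (of_real R * cis t)) * cmod (G (of_real R * cis t))"
        by (rule mult_right_mono) simp
      also have "\<dots> = cmod (g (of_real R * cis t))"
        using R by (subst gG) (auto simp: norm_mult)
      finally have "1 / 2 * cmod (G (of_real R * cis t)) \<le> cmod (g (of_real R * cis t))" .
      thus "cmod (G (of_real R * cis t)) \<le> 2 * cmod (g (of_real R * cis t))" by simp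
    qed (use R p in \<open>auto intro!: continuous_on_norm_powr_disk holg holG\<close>)
    also have "circle_mean (\<lambda>z. cmod (g z) powr p) R \<le> C" by (rule C) (use R in auto)
    finally show ?thesis by simp
  qed
  with h show ?thesis unfolding hardy_space_iff by blast
qed

text \<open>The factor of $a_i$ supplies $(z - a_i)^{m_i}$, and the product over the other indices does not vanish at $a_i$
because the zeros are distinct.\<close>
lemma blaschke_product_factor:
  assumes i: "i \<in> I" and inj: "inj_on a I" and \<gamma>: "\<gamma> \<noteq> 0"
  obtains k where "k holomorphic_on \<bbbD>" "k (a i) \<noteq> 0"
    "\<And>z. z \<in> \<bbbD> \<Longrightarrow> blaschke_product \<gamma> I a m z = (z - a i) ^ m i * k z"
proof -
  interpret J: blaschke_data "{i}" a m by (rule blaschke_data_subset) (use i in auto)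
  interpret K: blaschke_data "I - {i}" a m by (rule blaschke_data_subset) auto
  define k where "k = (\<lambda>z. \<gamma> * (- blaschke_normalizer (a i) / (1 - cnj (a i) * z)) ^ m i
                        * blaschke_product 1 (I - {i}) a m z)"
  have ai: "a i \<in> \<bbbD>" using zeros_in_disk[OF i] by simp
  have den: "1 - cnj (a i) * z \<noteq> 0" if "z \<in> \<bbbD>" for z
    using blaschke_denominator_ne[OF zeros_in_disk[OF i], of z] that by simp
  have "k holomorphic_on \<bbbD>" unfolding k_def
    by (intro holomorphic_intros K.holomorphic_on_blaschke_product den)
  moreover have "k (a i) \<noteq> 0"
  proof -
    have "blaschke_product 1 (I - {i}) a m (a i) \<noteq> 0"
      using K.blaschke_product_eq_0_iff[OF ai, of 1] inj i by (auto simp: inj_on_def)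
    moreover have "blaschke_normalizer (a i) \<noteq> 0"
      by (metis norm_blaschke_normalizer norm_zero zero_neq_one)
    ultimately show ?thesis using \<gamma> den[OF ai] by (simp add: k_def)
  qed
  moreover have "blaschke_product \<gamma> I a m z = (z - a i) ^ m i * k z" if z: "z \<in> \<bbbD>" for z
  proof -
    have "normalized_factor (a i) z = (z - a i) * (- blaschke_normalizer (a i) / (1 - cnj (a i) * z))"
      using den[OF z] by (simp add: blaschke_factor_def field_simps)
    hence "J.blaschke_term i z = (z - a i) ^ m i * (- blaschke_normalizer (a i) / (1 - cnj (a i) * z)) ^ m i"
      by (simp only: J.blaschke_term_def power_mult_distrib) simp
    hence "blaschke_product \<gamma> {i} a m z
        = \<gamma> * ((z - a i) ^ m i * (- blaschke_normalizer (a i) / (1 - cnj (a i) * z)) ^ m i)"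
      by (subst J.finite_blaschke_product_eq) (simp_all only: finite.intros prod.insert prod.empty
            finite.emptyI empty_iff not_False_eq_True mult_1_right)
    moreover have "blaschke_product \<gamma> I a m z
        = blaschke_product \<gamma> {i} a m z * blaschke_product 1 (I - {i}) a m z"
      by (rule blaschke_product_split) (use i z in auto)
    ultimately show ?thesis by (simp only: k_def mult_ac)
  qed
  ultimately show ?thesis using that by blast
qed

lemma zorder_blaschke_product:
  assumes i: "i \<in> I" and inj: "inj_on a I" and \<gamma>: "\<gamma> \<noteq> 0"
  shows "zorder (blaschke_product \<gamma> I a m) (a i) = int (m i)"
proof -
  obtain k where k: "k holomorphic_on \<bbbD>" "k (a i) \<noteq> 0"
    "\<And>z. z \<in> \<bbbD> \<Longrightarrow> blaschke_product \<gamma> I a m z = (z - a i) ^ m i * k z"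
    using blaschke_product_factor[OF assms] by blast
  show ?thesis
    by (rule zorder_eqI[of \<bbbD> _ k]) (use k zeros_in_disk[OF i] in auto)
qed

text \<open>The quotient $g / B$ coincides near each point with a holomorphic function, except possibly at that
point; hence all its singularities are removable.\<close>
lemma blaschke_product_divides:
  assumes g: "g holomorphic_on \<bbbD>" and inj: "inj_on a I" and \<gamma>: "\<gamma> \<noteq> 0"
    and fac: "\<And>i. i \<in> I \<Longrightarrow> \<exists>r>0. \<exists>k. k holomorphic_on ball (a i) r \<and>
                 (\<forall>z\<in>ball (a i) r. g z = (z - a i) ^ m i * k z)"
  obtains h where "h holomorphic_on \<bbbD>" "\<And>z. z \<in> \<bbbD> \<Longrightarrow> g z = blaschke_product \<gamma> I a m z * h z"
proof -
  define B where "B = blaschke_product \<gamma> I a m"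
  define f where "f = (\<lambda>z. g z / B z)"
  have holB: "B holomorphic_on \<bbbD>" unfolding B_def by (rule holomorphic_on_blaschke_product)
  have B0: "B z = 0 \<longleftrightarrow> (\<exists>i\<in>I. z = a i \<and> m i \<noteq> 0)" if "z \<in> \<bbbD>" for z
    unfolding B_def by (rule blaschke_product_eq_0_iff[OF that \<gamma>])
  have local_quotient: "\<exists>r>0. \<exists>q. q holomorphic_on ball z r \<and> (\<forall>w\<in>ball z r - {z}. f w = q w)"
    if z: "z \<in> \<bbbD>" for z
  proof (cases "B z = 0")
    case False
    have "open (\<bbbD> \<inter> B -` (- {0}))"
      by (rule continuous_open_preimage[OF holomorphic_on_imp_continuous_on[OF holB]]) auto
    moreover have "z \<in> \<bbbD> \<inter> B -` (- {0})" using z False by simp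
    ultimately obtain r where r: "r > 0" "ball z r \<subseteq> \<bbbD> \<inter> B -` (- {0})"
      by (rule openE)
    have "f holomorphic_on ball z r" unfolding f_def
      using r by (intro holomorphic_intros holomorphic_on_subset[OF g] holomorphic_on_subset[OF holB]) auto
    thus ?thesis using r(1) by blast
  next
    case True
    then obtain i where i: "i \<in> I" "z = a i" "m i \<noteq> 0" using B0[OF z] by blast
    obtain b where b: "b holomorphic_on \<bbbD>" "b z \<noteq> 0" "\<And>w. w \<in> \<bbbD> \<Longrightarrow> B w = (w - z) ^ m i * b w"
      using blaschke_product_factor[OF i(1) inj \<gamma>] i(2) unfolding B_def by metis
    obtain r k where r: "r > 0" and k: "k holomorphic_on ball z r"
        "\<And>w. w \<in> ball z r \<Longrightarrow> g w = (w - z) ^ m i * k w"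
      using fac[OF i(1)] i(2) by metis
    have "open (\<bbbD> \<inter> b -` (- {0}))"
      by (rule continuous_open_preimage[OF holomorphic_on_imp_continuous_on[OF b(1)]]) auto
    moreover have "z \<in> \<bbbD> \<inter> b -` (- {0})" using z b(2) by simp
    ultimately obtain s where s: "s > 0" "ball z s \<subseteq> \<bbbD> \<inter> b -` (- {0})"
      by (rule openE)
    have "(\<lambda>w. k w / b w) holomorphic_on ball z (min r s)"
      using s by (intro holomorphic_intros holomorphic_on_subset[OF k(1)] holomorphic_on_subset[OF b(1)]) auto
    moreover have "f w = k w / b w" if "w \<in> ball z (min r s) - {z}" for w
    proof -
      have "w \<in> \<bbbD>" "w \<in> ball z r" using that s by auto
      thus ?thesis using that by (simp add: f_def b(3) k(2))
    qed
    ultimately show ?thesis using r s by (intro exI[of _ "min r s"]) auto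
  qed
  have "remove_sings f analytic_on \<bbbD>"
    unfolding analytic_on_def
  proof
    fix z assume "z \<in> \<bbbD>"
    then obtain r q where r: "r > 0" and q: "q holomorphic_on ball z r" "\<And>w. w \<in> ball z r - {z} \<Longrightarrow> f w = q w"
      using local_quotient by blast
    have "q w = remove_sings f w" if w: "w \<in> ball z r" for w
    proof -
      have "\<forall>\<^sub>F x in at w. x \<in> ball z r" by (rule eventually_at_in_open') (use w in auto)
      moreover have "\<forall>\<^sub>F x in at w. x \<noteq> z" by (rule eventually_neq_at_within)
      ultimately have "\<forall>\<^sub>F x in at w. f x = q x" by eventually_elim (use q in auto)
      hence "remove_sings f w = remove_sings q w" by (rule remove_sings_cong) simp
      also have "\<dots> = q w" using q(1) w by (intro remove_sings_at_analytic) (auto simp: analytic_at)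
      finally show ?thesis ..
    qed
    thus "\<exists>\<epsilon>>0. remove_sings f holomorphic_on ball z \<epsilon>"
      using holomorphic_transform[OF q(1)] r by blast
  qed
  hence hol: "remove_sings f holomorphic_on \<bbbD>" by (rule analytic_imp_holomorphic)
  moreover have "g z = B z * remove_sings f z" if z: "z \<in> \<bbbD>" for z
  proof (cases "B z = 0")
    case True
    then obtain i where i: "i \<in> I" "z = a i" "m i \<noteq> 0" using B0[OF z] by blast
    have "g z = 0" using fac[OF i(1)] i by fastforce
    thus ?thesis using True by simp
  next
    case False
    have "f analytic_on {z}" unfolding f_def using g holB z False
      by (intro analytic_intros) (auto intro: holomorphic_on_imp_analytic_at)
    thus ?thesis using False by (simp add: f_def)
  qed
  ultimately show ?thesis using that unfolding B_def by blast
qed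

end

section \<open>Orders of vanishing and the invariance criterion\<close>

lemma order_of_vanishing:
  assumes hol: "\<phi> holomorphic_on S" "open S" "connected S" and z: "z \<in> S"
  obtains (const) "\<And>l. l \<ge> 1 \<Longrightarrow> (deriv ^^ l) \<phi> z = 0" "\<And>w. w \<in> S \<Longrightarrow> \<phi> w = \<phi> z"
  | (finite_order) n r \<psi> where "n \<ge> 1" "(deriv ^^ n) \<phi> z \<noteq> 0" "\<And>l. 1 \<le> l \<Longrightarrow> l < n \<Longrightarrow> (deriv ^^ l) \<phi> z = 0"
      "r > 0" "ball z r \<subseteq> S" "\<psi> holomorphic_on ball z r" "\<psi> z \<noteq> 0"
      "\<And>w. w \<in> ball z r \<Longrightarrow> \<phi> w - \<phi> z = (w - z) ^ n * \<psi> w"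
proof (cases "\<forall>l\<ge>1. (deriv ^^ l) \<phi> z = 0")
  case True
  have "\<phi> w = \<phi> z" if "w \<in> S" for w
    by (rule holomorphic_fun_eq_const_on_connected[OF hol _ z that]) (use True in auto)
  thus ?thesis using True const by blast
next
  case False
  define n where "n = (LEAST l. l \<ge> 1 \<and> (deriv ^^ l) \<phi> z \<noteq> 0)"
  have n: "n \<ge> 1" "(deriv ^^ n) \<phi> z \<noteq> 0"
    using LeastI_ex[of "\<lambda>l. l \<ge> 1 \<and> (deriv ^^ l) \<phi> z \<noteq> 0"] False unfolding n_def by blast+
  have min: "(deriv ^^ l) \<phi> z = 0" if "1 \<le> l" "l < n" for l
    using not_less_Least[of l "\<lambda>l. l \<ge> 1 \<and> (deriv ^^ l) \<phi> z \<noteq> 0"] that unfolding n_def by blast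
  obtain \<psi> r where \<psi>: "0 < r" "\<psi> holomorphic_on ball z r"
      "\<And>w. w \<in> ball z r \<Longrightarrow> \<phi> w - \<phi> z = (w - z) ^ n * \<psi> w"
      "\<And>w. w \<in> ball z r \<Longrightarrow> \<psi> w \<noteq> 0"
    by (rule holomorphic_factor_order_of_zero[OF hol(1,2) z, of n]) (use n min in auto)
  obtain s where s: "s > 0" "ball z s \<subseteq> S" using hol(2) z by (meson openE)
  show ?thesis
    by (rule finite_order[of n "min r s" \<psi>])
       (use n min \<psi> s in \<open>auto elim: holomorphic_on_subset\<close>)
qed

lemma ceiling_divide_le_iff:
  fixes k n :: nat and x :: nat
  assumes "n > 0"
  shows "\<lceil>real k / real n\<rceil> \<le> int x \<longleftrightarrow> k \<le> x * n"
proof -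
  have "\<lceil>real k / real n\<rceil> \<le> int x \<longleftrightarrow> real k \<le> real (x * n)"
    using assms by (simp add: ceiling_le_iff field_simps)
  thus ?thesis by (simp only: of_nat_le_iff)
qed

lemma one_in_hardy_space: "(\<lambda>_. 1) \<in> hardy_space p"
  unfolding hardy_space_iff circle_mean_def by auto

theorem theorem5p12:
  fixes p :: real
    and \<gamma> :: complex
    and I :: "nat set"
    and a :: "nat \<Rightarrow> complex"
    and m :: "nat \<Rightarrow> nat"
    and B \<phi> :: "complex \<Rightarrow> complex"
  assumes "0 < p"
    and "cmod \<gamma> = 1"
    and "\<And>i. i \<in> I \<Longrightarrow> a i \<in> \<bbbD>"
    and "inj_on a I"
    and "\<And>i. i \<in> I \<Longrightarrow> m i \<ge> 1"
    and "(\<lambda>i. real (m i) * (1 - cmod (a i))) summable_on I"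
    and "B = blaschke_product \<gamma> I a m"
    and "\<phi> holomorphic_on \<bbbD>"
    and "\<phi> ` \<bbbD> \<subseteq> \<bbbD>"
    and "\<phi> ` (a ` I) \<subseteq> a ` I"
  shows "composition_op \<phi> ` mult_hardy_space B p \<subseteq> mult_hardy_space B p \<longleftrightarrow>
    (\<forall>i\<in>I. zorder B (a i) > zorder B (\<phi> (a i)) \<longrightarrow>
      (\<forall>l::nat. 1 \<le> l \<and>
          int l \<le> \<lceil>real_of_int (zorder B (a i)) / real_of_int (zorder B (\<phi> (a i)))\<rceil> - 1
        \<longrightarrow> (deriv ^^ l) \<phi> (a i) = 0))"
proof -
  interpret blaschke_data I a m by unfold_locales (use assms in auto)
  have \<gamma>0: "\<gamma> \<noteq> 0" using assms(2) by auto
  have holB: "B holomorphic_on \<bbbD>" unfolding assms(7) by (rule holomorphic_on_blaschke_product)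
  have zord: "zorder B (a i) = int (m i)" if "i \<in> I" for i
    unfolding assms(7) by (rule zorder_blaschke_product[OF that assms(4) \<gamma>0])
  have \<phi>a: "\<exists>j\<in>I. \<phi> (a i) = a j" if "i \<in> I" for i using assms(10) that by auto
  have \<phi>D: "\<phi> w \<in> \<bbbD>" if "w \<in> \<bbbD>" for w using assms(9) that by blast
  \<comment> \<open>In the first direction only the function B itself, that is f = 1, is tested.\<close>
  show ?thesis
  proof (intro iffI ballI impI allI subsetI; (elim conjE)?)
    fix i l
    assume invariant: "composition_op \<phi> ` mult_hardy_space B p \<subseteq> mult_hardy_space B p"
      and i: "i \<in> I" and l: "1 \<le> l"
        "int l \<le> \<lceil>real_of_int (zorder B (a i)) / real_of_int (zorder B (\<phi> (a i)))\<rceil> - 1"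
    obtain j where j: "j \<in> I" "\<phi> (a i) = a j" using \<phi>a[OF i] by blast
    define z where "z = a i"
    have z: "z \<in> \<bbbD>" using assms(3)[OF i] by (simp add: z_def)
    \<comment> \<open>The range of l says exactly that order l is too small for B o phi to vanish to order m i.\<close>
    have ml: "l * m j < m i"
      using l(2) ceiling_divide_le_iff[of "m j" "m i" l] assms(5)[OF j(1)] zord[OF i] zord[OF j(1)] j(2)
      by force
    have "B \<in> mult_hardy_space B p"
      using one_in_hardy_space[of p] unfolding mult_hardy_space_def by force
    hence "B \<circ> \<phi> \<in> mult_hardy_space B p" using invariant by (auto simp: composition_op_def)
    then obtain f where "f \<in> hardy_space p" "\<forall>w\<in>\<bbbD>. (B \<circ> \<phi>) w = B w * f w"
      unfolding mult_hardy_space_def by blast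
    hence f: "f holomorphic_on \<bbbD>" "\<And>w. w \<in> \<bbbD> \<Longrightarrow> B (\<phi> w) = B w * f w"
      by (simp_all add: hardy_space_iff)
    obtain ki where ki: "ki holomorphic_on \<bbbD>" "\<And>w. w \<in> \<bbbD> \<Longrightarrow> B w = (w - z) ^ m i * ki w"
      using blaschke_product_factor[OF i assms(4) \<gamma>0] unfolding assms(7) z_def by metis
    obtain kj where kj: "kj holomorphic_on \<bbbD>" "kj (a j) \<noteq> 0" "\<And>w. w \<in> \<bbbD> \<Longrightarrow> B w = (w - a j) ^ m j * kj w"
      using blaschke_product_factor[OF j(1) assms(4) \<gamma>0] unfolding assms(7) by metis
    show "(deriv ^^ l) \<phi> (a i) = 0"
    proof (rule order_of_vanishing[OF assms(8) open_ball connected_ball z], goal_cases)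
      case 1
      thus ?thesis using l(1) by (simp add: z_def)
    next
      case (2 n r \<psi>)
      show ?thesis
      proof (rule ccontr)
        assume "(deriv ^^ l) \<phi> (a i) \<noteq> 0"
        hence "n \<le> l" using 2(3)[of l] l(1) by (force simp: z_def)
        hence nm: "n * m j < m i" using ml by (meson le_less_trans mult_le_mono1)
        \<comment> \<open>Dividing B o phi = B f by (w - z)^(n m_j) leaves L, which is nonzero at z, and M, which vanishes there.\<close>
        define L where "L = (\<lambda>w. \<psi> w ^ m j * kj (\<phi> w))"
        define M where "M = (\<lambda>w. (w - z) ^ (m i - n * m j) * (ki w * f w))"
        have LM: "L w = M w" if w: "w \<in> ball z r - {z}" for w
        proof -
          have wD: "w \<in> \<bbbD>" using w 2(5) by blast
          have "B (\<phi> w) = (\<phi> w - \<phi> z) ^ m j * kj (\<phi> w)"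
            using kj(3)[OF \<phi>D[OF wD]] j(2) by (simp add: z_def)
          also have "\<dots> = (w - z) ^ (n * m j) * L w"
            using 2(8)[of w] w by (simp add: L_def power_mult_distrib power_mult)
          finally have "(w - z) ^ (n * m j) * L w = (w - z) ^ (n * m j + (m i - n * m j)) * (ki w * f w)"
            using f(2)[OF wD] ki(2)[OF wD] nm by (simp add: mult.assoc)
          also have "\<dots> = (w - z) ^ (n * m j) * M w" by (simp add: M_def power_add)
          finally show ?thesis using w by simp
        qed
        have "isCont L z"
        proof -
          have "(\<lambda>w. kj (\<phi> w)) holomorphic_on \<bbbD>"
            using holomorphic_on_compose_gen[OF assms(8) kj(1) assms(9)] by (simp add: o_def)
          hence "L holomorphic_on ball z r" unfolding L_def
            using 2 by (intro holomorphic_intros) (auto elim: holomorphic_on_subset)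
          thus ?thesis using 2(4) by (meson centre_in_ball continuous_on_eq_continuous_at holomorphic_on_imp_continuous_on open_ball)
        qed
        hence L: "L \<midarrow>z\<rightarrow> L z" by (simp add: isCont_def)
        have "M holomorphic_on \<bbbD>" unfolding M_def by (intro holomorphic_intros ki f)
        hence "isCont M z"
          using z by (meson continuous_on_eq_continuous_at holomorphic_on_imp_continuous_on open_ball)
        hence M: "M \<midarrow>z\<rightarrow> M z" by (simp add: isCont_def)
        have "\<forall>\<^sub>F w in at z. w \<in> ball z r - {z}" by (rule eventually_at_in_open) (use 2(4) in auto)
        hence "\<forall>\<^sub>F w in at z. L w = M w" by eventually_elim (rule LM)
        hence "L \<midarrow>z\<rightarrow> M z" using M by (subst tendsto_cong) 
        hence "L z = M z" using L by (rule tendsto_unique[OF at_neq_bot _ , rotated])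
        moreover have "M z = 0" using nm by (simp add: M_def)
        moreover have "L z \<noteq> 0" using 2(7) kj(2) j(2) by (simp add: L_def z_def)
        ultimately show False by simp
      qed
    qed
  next
    fix x
    assume cond: "\<forall>i\<in>I. zorder B (a i) > zorder B (\<phi> (a i)) \<longrightarrow>
      (\<forall>l::nat. 1 \<le> l \<and>
          int l \<le> \<lceil>real_of_int (zorder B (a i)) / real_of_int (zorder B (\<phi> (a i)))\<rceil> - 1
        \<longrightarrow> (deriv ^^ l) \<phi> (a i) = 0)"
      and "x \<in> composition_op \<phi> ` mult_hardy_space B p"
    then obtain g f where g: "x = g \<circ> \<phi>" "f \<in> hardy_space p" "\<And>z. z \<in> \<bbbD> \<Longrightarrow> g z = B z * f z"
      by (auto simp: composition_op_def mult_hardy_space_def)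
    define G where "G = (\<lambda>z. B (\<phi> z) * f (\<phi> z))"
    have holf: "f holomorphic_on \<bbbD>" using g(2) by (simp add: hardy_space_iff)
    have comp: "(\<lambda>z. u (\<phi> z)) holomorphic_on \<bbbD>" if "u holomorphic_on \<bbbD>" for u
      using holomorphic_on_compose_gen[OF assms(8) that assms(9)] by (simp add: o_def)
    have G: "G \<in> hardy_space p" unfolding G_def
    proof (rule hardy_space_bounded_mult)
      show "(\<lambda>z. f (\<phi> z)) \<in> hardy_space p" by (rule hardy_space_compose[OF g(2) assms(8,9,1)])
      show "(\<lambda>z. B (\<phi> z)) holomorphic_on \<bbbD>" by (rule comp[OF holB])
      show "cmod (B (\<phi> z)) \<le> 1" if "z \<in> \<bbbD>" for z
        unfolding assms(7) by (rule norm_blaschke_product_le[OF \<phi>D[OF that] assms(2)])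
    qed (rule assms(1))
    have holG: "G holomorphic_on \<bbbD>" using G by (simp add: hardy_space_iff)
    have fac: "\<exists>r>0. \<exists>k. k holomorphic_on ball (a i) r \<and> (\<forall>z\<in>ball (a i) r. G z = (z - a i) ^ m i * k z)"
      if i: "i \<in> I" for i
    proof -
      obtain j where j: "j \<in> I" "\<phi> (a i) = a j" using \<phi>a[OF i] by blast
      have mj: "m j \<ge> 1" using assms(5)[OF j(1)] .
      obtain kj where kj: "kj holomorphic_on \<bbbD>" "\<And>w. w \<in> \<bbbD> \<Longrightarrow> B w = (w - a j) ^ m j * kj w"
        using blaschke_product_factor[OF j(1) assms(4) \<gamma>0] unfolding assms(7) by metis
      show ?thesis
      proof (rule order_of_vanishing[OF assms(8) open_ball connected_ball assms(3)[OF i]], goal_cases)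
        case 1
        obtain r where r: "r > 0" "ball (a i) r \<subseteq> \<bbbD>" using assms(3)[OF i] by (meson open_ball openE)
        have "G z = 0" if "z \<in> \<bbbD>" for z
          using kj(2)[OF \<phi>D[OF that]] 1(2)[OF that] j(2) mj by (simp add: G_def)
        thus ?thesis using r by (intro exI[of _ r] conjI exI[of _ "\<lambda>_. 0"]) auto
      next
        case (2 n r \<psi>)
        have le: "m i \<le> n * m j"
        proof (rule ccontr)
          assume "\<not> m i \<le> n * m j"
          hence lt: "n * m j < m i" by simp
          hence "m j < m i" using 2(1) by (metis le_less_trans mult_1 mult_le_mono1)
          \<comment> \<open>If n m_j < m_i, then the hypothesis makes the first nonzero derivative vanish.\<close>
          moreover have "\<not> \<lceil>real (m i) / real (m j)\<rceil> \<le> int n"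
            using ceiling_divide_le_iff[of "m j" "m i" n] lt mj by simp
          ultimately have "(deriv ^^ n) \<phi> (a i) = 0"
            using cond i 2(1) zord[OF i] zord[OF j(1)] j(2) by simp
          thus False using 2(2) by simp
        qed
        define k where "k = (\<lambda>z. (z - a i) ^ (n * m j - m i) * \<psi> z ^ m j * (kj (\<phi> z) * f (\<phi> z)))"
        have "k holomorphic_on ball (a i) r" unfolding k_def
          using 2 by (intro holomorphic_intros holomorphic_on_subset[OF comp[OF kj(1)]]
              holomorphic_on_subset[OF comp[OF holf]])
        moreover have "G z = (z - a i) ^ m i * k z" if z: "z \<in> ball (a i) r" for z
        proof -
          have "G z = (\<phi> z - \<phi> (a i)) ^ m j * (kj (\<phi> z) * f (\<phi> z))"
            using kj(2)[OF \<phi>D[of z]] z 2(5) j(2) by (auto simp: G_def)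
          also have "\<dots> = (z - a i) ^ (m i + (n * m j - m i)) * \<psi> z ^ m j * (kj (\<phi> z) * f (\<phi> z))"
            using 2(8)[OF z] le by (simp add: power_mult_distrib power_mult)
          also have "\<dots> = (z - a i) ^ m i * k z" by (simp only: k_def power_add mult_ac)
          finally show ?thesis .
        qed
        ultimately show ?thesis using 2(4) by blast
      qed
    qed
    obtain h where h: "h holomorphic_on \<bbbD>" "\<And>z. z \<in> \<bbbD> \<Longrightarrow> G z = B z * h z"
      using blaschke_product_divides[OF holG assms(4) \<gamma>0 fac] unfolding assms(7) by blast
    have "h \<in> hardy_space p"
      by (rule hardy_space_divide[OF G h(1) _ assms(2,1)]) (use h(2) in \<open>simp add: assms(7)\<close>)
    moreover have "x z = B z * h z" if "z \<in> \<bbbD>" for z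
      using g(1) g(3)[OF \<phi>D[OF that]] h(2)[OF that] by (simp add: G_def)
    ultimately show "x \<in> mult_hardy_space B p" unfolding mult_hardy_space_def by blast
  qed
qed

end
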